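(* Let $m\ge1$ be an integer. The map $\Phi:(\underline{c},\underline{d})\mapsto\dim_H(M_{\underline{c},\underline{d}}')$, defined for pairs $\underline{c},\underline{d}\in\Sigma_{m+1}$ with $\underline{c}<\underline{d}$, is continuous.
   Context: $\Sigma_{m+1}=\{0,1,\ldots,m\}^{\mathbb{N}}$ (sequences $\underline{x}=(x_1,x_2,\ldots)$) is equipped with the shift $(\sigma(\underline{x}))_i=x_{i+1}$, the lexicographic order $<$, the product topology, and the compatible metric $d(\underline{a},\underline{b})=\sum_{i\ge1}|a_i-b_i|/(m+1)^i$, with respect to which Hausdorff dimension $\dim_H$ is taken. For $\underline{c},\underline{d}\in\Sigma_{m+1}$, $$M_{\underline{c},\underline{d}}'=\{\underline{x}\in\Sigma_{m+1}:\ \underline{c}\le\sigma^n(\underline{x})\le\underline{d},\ \forall n\ge0\}.$$ The set of pairs $(\underline{c},\underline{d})$ carries the topology induced from $\Sigma_{m+1}\times\Sigma_{m+1}$. *)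

theory Defs
  imports "HOL-Analysis.Analysis" "HOL-Library.Fun_Lexorder"
begin

section \<open>Hausdorff measure and dimension in a metric space\<close>

definition ediam :: "'a metric \<Rightarrow> 'a set \<Rightarrow> ennreal" where
  "ediam X U = (SUP x\<in>U. SUP y\<in>U. ennreal (mdist X x y))"

text \<open>The \<open>s\<close>-th power of the diameter, with \<open>|\<emptyset>|\<^sup>0 = 0\<close> and \<open>|U|\<^sup>0 = 1\<close> for nonempty \<open>U\<close>, so that the
  0-dimensional measure counts points. (Note that \<open>0 powr 0 = 0\<close>, whence the case split.)
  It is only used for sets of finite diameter.\<close>

definition diam_pow :: "'a metric \<Rightarrow> real \<Rightarrow> 'a set \<Rightarrow> ennreal" where
  "diam_pow X s U =
    (if U = {} then 0 else if s = 0 then 1 else ennreal (enn2real (ediam X U) powr s))"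

text \<open>Countable covers are sequences of sets; finite covers are padded with \<open>\<emptyset>\<close>.\<close>

definition hausdorff_premeasure :: "'a metric \<Rightarrow> real \<Rightarrow> real \<Rightarrow> 'a set \<Rightarrow> ennreal" where
  "hausdorff_premeasure X s \<delta> A =
    (INF U\<in>{U :: nat \<Rightarrow> 'a set. A \<subseteq> (\<Union>n. U n) \<and>
        (\<forall>n. U n \<subseteq> mspace X \<and> ediam X (U n) \<le> ennreal \<delta>)}.
      \<Sum>n. diam_pow X s (U n))"

definition hausdorff_measure :: "'a metric \<Rightarrow> real \<Rightarrow> 'a set \<Rightarrow> ennreal" where
  "hausdorff_measure X s A = (SUP \<delta>\<in>{0<..}. hausdorff_premeasure X s \<delta> A)"

text \<open>With this definition the empty set has dimension 0.\<close>

definition hausdorff_dim :: "'a metric \<Rightarrow> 'a set \<Rightarrow> ennreal" where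
  "hausdorff_dim X A = (INF s\<in>{s. 0 \<le> s \<and> hausdorff_measure X s A = 0}. ennreal s)"


section \<open>The full shift and lexicographic subshifts\<close>

text \<open>Sequences are indexed from 0, so the \<open>i\<close>-th entry here is the entry \<open>i + 1\<close> of the
  usual notation.\<close>

definition full_shift :: "nat \<Rightarrow> (nat \<Rightarrow> nat) set" where
  "full_shift m = {x. \<forall>i. x i \<le> m}"

definition shift :: "(nat \<Rightarrow> nat) \<Rightarrow> nat \<Rightarrow> nat" where
  "shift x = (\<lambda>i. x (Suc i))"

text \<open>The order \<open>\<le>\<close> on functions is pointwise; the lexicographic order is \<^const>\<open>less_fun\<close>.\<close>

definition lex_le :: "(nat \<Rightarrow> nat) \<Rightarrow> (nat \<Rightarrow> nat) \<Rightarrow> bool" where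
  "lex_le x y \<longleftrightarrow> x = y \<or> less_fun x y"

text \<open>The use of \<^const>\<open>infsum\<close> makes the distance 0 where the series diverges (outside
  \<open>full_shift m\<close>), since a metric on a carrier must be nonnegative on the whole type.\<close>

definition seq_dist :: "nat \<Rightarrow> (nat \<Rightarrow> nat) \<Rightarrow> (nat \<Rightarrow> nat) \<Rightarrow> real" where
  "seq_dist m a b = (\<Sum>\<^sub>\<infinity>i. \<bar>real (a i) - real (b i)\<bar> / real (m + 1) ^ (i + 1))"

definition shift_metric :: "nat \<Rightarrow> (nat \<Rightarrow> nat) metric" where
  "shift_metric m = metric (full_shift m, seq_dist m)"

definition lex_subshift :: "nat \<Rightarrow> (nat \<Rightarrow> nat) \<Rightarrow> (nat \<Rightarrow> nat) \<Rightarrow> (nat \<Rightarrow> nat) set" where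
  "lex_subshift m c d =
    {x \<in> full_shift m. \<forall>n. lex_le c ((shift ^^ n) x) \<and> lex_le ((shift ^^ n) x) d}"


section \<open>The metric is well defined and induces the product topology\<close>

lemma seq_dist_summable:
  assumes "a \<in> full_shift m" "b \<in> full_shift m"
  shows "summable (\<lambda>i. \<bar>real (a i) - real (b i)\<bar> / real (m + 1) ^ (i + 1))"
proof (cases "m = 0")
  case True
  then show ?thesis using assms by (simp add: full_shift_def)
next
  case False
  show ?thesis
  proof (rule summable_comparison_test'[where N = 0])
    show "summable (\<lambda>i. real m * (1 / real (m + 1)) ^ (i + 1))"
      using False by (intro summable_mult) (auto simp: summable_Suc_iff intro!: summable_geometric)
    fix i
    have "real (a i) \<le> real m" "real (b i) \<le> real m"
      using assms by (auto simp: full_shift_def)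
    then have "\<bar>real (a i) - real (b i)\<bar> \<le> real m" by linarith
    then show "norm (\<bar>real (a i) - real (b i)\<bar> / real (m + 1) ^ (i + 1))
        \<le> real m * (1 / real (m + 1)) ^ (i + 1)"
      by (simp add: power_divide divide_right_mono)
  qed
qed

lemma seq_dist_suminf:
  assumes "a \<in> full_shift m" "b \<in> full_shift m"
  shows "seq_dist m a b = (\<Sum>i. \<bar>real (a i) - real (b i)\<bar> / real (m + 1) ^ (i + 1))"
  unfolding seq_dist_def
proof (rule infsumI)
  show "((\<lambda>i. \<bar>real (a i) - real (b i)\<bar> / real (m + 1) ^ (i + 1)) has_sum
      (\<Sum>i. \<bar>real (a i) - real (b i)\<bar> / real (m + 1) ^ (i + 1))) UNIV"
    using seq_dist_summable[OF assms]
    by (intro norm_summable_imp_has_sum) (auto simp: summable_sums)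
qed

lemma seq_dist_nonneg: "0 \<le> seq_dist m a b"
  unfolding seq_dist_def by (intro infsum_nonneg) simp

lemma seq_dist_term_le:
  assumes "a \<in> full_shift m" "b \<in> full_shift m"
  shows "\<bar>real (a k) - real (b k)\<bar> / real (m + 1) ^ (k + 1) \<le> seq_dist m a b"
  using sum_le_suminf[OF seq_dist_summable[OF assms], of "{k}"]
  unfolding seq_dist_suminf[OF assms] by simp

lemma Metric_space_full_shift: "Metric_space (full_shift m) (seq_dist m)"
proof
  fix x y z :: "nat \<Rightarrow> nat"
  show "0 \<le> seq_dist m x y" by (rule seq_dist_nonneg)
  show "seq_dist m x y = seq_dist m y x"
    by (simp add: seq_dist_def abs_minus_commute)
  show "seq_dist m x y = 0 \<longleftrightarrow> x = y" if xy: "x \<in> full_shift m" "y \<in> full_shift m"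
  proof
    assume "seq_dist m x y = 0"
    then have "\<bar>real (x k) - real (y k)\<bar> / real (m + 1) ^ (k + 1) \<le> 0" for k
      using seq_dist_term_le[OF xy, of k] by simp
    moreover have "0 < real (m + 1) ^ (k + 1)" for k by simp
    ultimately have "\<bar>real (x k) - real (y k)\<bar> \<le> 0" for k
      by (metis divide_le_0_iff not_less)
    then have "x k = y k" for k by simp
    then show "x = y" by blast
  qed (simp add: seq_dist_def)
  show "seq_dist m x z \<le> seq_dist m x y + seq_dist m y z"
    if xyz: "x \<in> full_shift m" "y \<in> full_shift m" "z \<in> full_shift m"
    unfolding seq_dist_suminf[OF xyz(1,2)] seq_dist_suminf[OF xyz(2,3)] seq_dist_suminf[OF xyz(1,3)]
    unfolding suminf_add[OF seq_dist_summable[OF xyz(1,2)] seq_dist_summable[OF xyz(2,3)]]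
  proof (rule suminf_le)
    show "summable (\<lambda>i. \<bar>real (x i) - real (z i)\<bar> / real (m + 1) ^ (i + 1))"
      by (rule seq_dist_summable[OF xyz(1,3)])
    show "summable (\<lambda>i. \<bar>real (x i) - real (y i)\<bar> / real (m + 1) ^ (i + 1)
        + \<bar>real (y i) - real (z i)\<bar> / real (m + 1) ^ (i + 1))"
      by (intro summable_add seq_dist_summable xyz)
    show "\<bar>real (x i) - real (z i)\<bar> / real (m + 1) ^ (i + 1)
      \<le> \<bar>real (x i) - real (y i)\<bar> / real (m + 1) ^ (i + 1)
        + \<bar>real (y i) - real (z i)\<bar> / real (m + 1) ^ (i + 1)" for i
      unfolding add_divide_distrib[symmetric] by (intro divide_right_mono) auto
  qed
qed

lemma mspace_shift_metric [simp]: "mspace (shift_metric m) = full_shift m"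
  by (simp add: shift_metric_def Metric_space.mspace_metric[OF Metric_space_full_shift])

lemma mdist_shift_metric [simp]: "mdist (shift_metric m) = seq_dist m"
  by (simp add: shift_metric_def Metric_space.mdist_metric[OF Metric_space_full_shift])

lemma seq_dist_less_imp_eq:
  assumes xy: "x \<in> full_shift m" "y \<in> full_shift m"
    and less: "seq_dist m x y < 1 / real (m + 1) ^ N" and k: "k < N"
  shows "x k = y k"
proof (rule ccontr)
  assume "x k \<noteq> y k"
  then have "1 \<le> \<bar>real (x k) - real (y k)\<bar>" by linarith
  then have "1 / real (m + 1) ^ (k + 1) \<le> \<bar>real (x k) - real (y k)\<bar> / real (m + 1) ^ (k + 1)"
    by (intro divide_right_mono) auto
  also have "\<dots> \<le> seq_dist m x y" by (rule seq_dist_term_le[OF xy])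
  also note less
  also have "1 / real (m + 1) ^ N \<le> 1 / real (m + 1) ^ (k + 1)"
    using k by (intro divide_left_mono power_increasing) auto
  finally show False by simp
qed

lemma seq_dist_le_if_eq:
  assumes xy: "x \<in> full_shift m" "y \<in> full_shift m"
    and m: "1 \<le> m" and eq: "\<And>k. k < N \<Longrightarrow> x k = y k"
  shows "seq_dist m x y \<le> 1 / real (m + 1) ^ N"
proof -
  let ?t = "\<lambda>i. \<bar>real (x i) - real (y i)\<bar> / real (m + 1) ^ (i + 1)"
  let ?q = "1 / real (m + 1)"
  have q: "norm ?q < 1" using m by simp
  have "seq_dist m x y = (\<Sum>i. ?t (i + N)) + (\<Sum>i<N. ?t i)"
    unfolding seq_dist_suminf[OF xy] by (rule suminf_split_initial_segment[OF seq_dist_summable[OF xy]])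
  also have "(\<Sum>i<N. ?t i) = 0" using eq by simp
  also have "(\<Sum>i. ?t (i + N)) + 0 \<le> (\<Sum>i. real m * ?q ^ (N + 1) * ?q ^ i)"
    unfolding add_0_right
  proof (rule suminf_le)
    show "summable (\<lambda>i. ?t (i + N))"
      by (rule summable_ignore_initial_segment[OF seq_dist_summable[OF xy]])
    show "summable (\<lambda>i. real m * ?q ^ (N + 1) * ?q ^ i)"
      by (intro summable_mult summable_geometric q)
    fix i
    have "real (x (i + N)) \<le> real m" "real (y (i + N)) \<le> real m"
      using xy by (auto simp: full_shift_def)
    then have "\<bar>real (x (i + N)) - real (y (i + N))\<bar> \<le> real m" by linarith
    then have "?t (i + N) \<le> real m / real (m + 1) ^ (i + N + 1)"
      by (intro divide_right_mono) auto
    also have "\<dots> = real m * ?q ^ (N + 1) * ?q ^ i"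
      by (simp add: power_add power_divide mult_ac)
    finally show "?t (i + N) \<le> real m * ?q ^ (N + 1) * ?q ^ i" .
  qed
  also have "\<dots> = real m * ?q ^ (N + 1) * (1 / (1 - ?q))"
    by (simp only: suminf_mult[OF summable_geometric[OF q]] suminf_geometric[OF q])
  also have "1 / (1 - ?q) = real (m + 1) / real m"
    using m by (simp add: field_simps)
  also have "real m * ?q ^ (N + 1) * (real (m + 1) / real m) = 1 / real (m + 1) ^ N"
    using m by (simp add: power_divide del: of_nat_add of_nat_Suc)
  finally show ?thesis .
qed

lemma mtopology_shift_metric:
  assumes m: "1 \<le> m"
  shows "mtopology_of (shift_metric m) = top_of_set (full_shift m)"
proof -
  interpret Metric_space "full_shift m" "seq_dist m" by (rule Metric_space_full_shift)
  have "openin mtopology U \<longleftrightarrow> openin (top_of_set (full_shift m)) U" for U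
  proof
    assume U: "openin mtopology U"
    show "openin (top_of_set (full_shift m)) U"
    proof (subst openin_subopen, intro ballI)
      fix x assume x: "x \<in> U"
      with U obtain r where r: "r > 0" "mball x r \<subseteq> U" and xm: "x \<in> full_shift m"
        unfolding openin_mtopology by blast
      obtain N where N: "(1 / real (m + 1)) ^ N < r"
        using real_arch_pow_inv[of r "1 / real (m + 1)"] r m by auto
      define C where "C = (\<Inter>i\<in>{..<N}. (\<lambda>y. y i) -` {x i})"
      have "open C" unfolding C_def
        by (intro open_INT finite_lessThan ballI open_vimage continuous_on_product_coordinates)
           (simp add: open_discrete)
      moreover have "full_shift m \<inter> C \<subseteq> U"
      proof
        fix y assume y: "y \<in> full_shift m \<inter> C"
        have "seq_dist m x y \<le> 1 / real (m + 1) ^ N"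
          using y xm m by (intro seq_dist_le_if_eq) (auto simp: C_def)
        with N have "seq_dist m x y < r" by (simp add: power_divide)
        with y xm r show "y \<in> U" by (auto simp: subset_iff)
      qed
      moreover have "x \<in> full_shift m \<inter> C" using xm by (simp add: C_def)
      ultimately show "\<exists>T. openin (top_of_set (full_shift m)) T \<and> x \<in> T \<and> T \<subseteq> U"
        by (meson openin_open_Int)
    qed
  next
    assume "openin (top_of_set (full_shift m)) U"
    then obtain V where V: "open V" "U = full_shift m \<inter> V" by (auto simp: openin_open)
    show "openin mtopology U"
      unfolding openin_mtopology
    proof (intro conjI allI impI)
      show "U \<subseteq> full_shift m" using V by blast
      fix x assume x: "x \<in> U"
      with V have "openin (product_topology (\<lambda>i. euclidean) UNIV) V" "x \<in> V"
        by (auto simp: open_fun_def)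
      from product_topology_open_contains_basis[OF this] obtain X where
        X: "x \<in> Pi\<^sub>E UNIV X" "finite {i. X i \<noteq> UNIV}" "Pi\<^sub>E UNIV X \<subseteq> V"
        by auto
      then obtain N where N: "\<And>i. X i \<noteq> UNIV \<Longrightarrow> i < N"
        by (metis (mono_tags, lifting) finite_nat_set_iff_bounded mem_Collect_eq)
      have "mball x (1 / real (m + 1) ^ N) \<subseteq> U"
      proof
        fix y assume "y \<in> mball x (1 / real (m + 1) ^ N)"
        then have y: "x \<in> full_shift m" "y \<in> full_shift m" "seq_dist m x y < 1 / real (m + 1) ^ N"
          by auto
        have "y i \<in> X i" for i
        proof (cases "i < N")
          case True
          with seq_dist_less_imp_eq[OF y] X(1) show ?thesis by (metis PiE_E UNIV_I)
        qed (use N in blast)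
        then have "y \<in> Pi\<^sub>E UNIV X" by auto
        with X V y show "y \<in> U" by blast
      qed
      then show "\<exists>r>0. mball x r \<subseteq> U"
        by (intro exI[of _ "1 / real (m + 1) ^ N"]) auto
    qed
  qed
  then show ?thesis
    unfolding shift_metric_def mtopology_of by (simp add: topology_eq)
qed

end

theory Submission
  imports Defs "HOL-Library.Omega_Words_Fun" "HOL-Complex_Analysis.Conformal_Mappings"
begin

text \<open>Upper semicontinuity of the dimension is a compactness matter. The set
\<open>M = lex_subshift m c d\<close> is the decreasing intersection of sets that only constrain finitely many
letters. If \<open>M\<close> is a null set for the \<open>s\<close>-dimensional measure, it is covered by finitely many
cylinders \<open>[w]\<close>, \<open>w \<in> D\<close>, with \<open>\<Sum>w\<in>D. (m + 1) powr (- s * length w) \<le> 1\<close>, and the same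
cylinders still cover \<open>lex_subshift m c' d'\<close> for all \<open>(c', d')\<close> that agree with \<open>(c, d)\<close> long enough.
Chopping off words of \<open>D\<close> again and again gives a renewal inequality for the number of prefixes, so
these sets have dimension at most \<open>s\<close> (\<open>hausdorff_null_nearby\<close>).

Lower semicontinuity is the real content: cutting small neighbourhoods of \<open>c\<close> and \<open>d\<close> out of the system
must not lower the dimension by a jump. Let \<open>c\<^sub>k\<close> follow \<open>c\<close> for \<open>k\<close> letters and continue with \<open>m\<close>, and
let \<open>d\<^sub>k\<close> follow \<open>d\<close> for \<open>k\<close> letters and continue with \<open>0\<close>. Every \<open>(c', d')\<close> near \<open>(c, d)\<close> satisfies
\<open>c' \<le> c\<^sub>k\<close> and \<open>d\<^sub>k \<le> d'\<close>, so it suffices that the dimensions for \<open>(c\<^sub>k, d\<^sub>k)\<close> do not stay below that for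
\<open>(c, d)\<close> (\<open>hausdorff_null_limit\<close>).

The tool is a kneading identity. Let \<open>N n y\<close> be the number of words \<open>v\<close> of length \<open>n\<close> such that
all of the first \<open>n\<close> shifts of \<open>v \<frown> y\<close> lie strictly between \<open>c\<close> and \<open>d\<close>. As a function of \<open>y\<close> it is a
step function. It jumps up by \<open>N (n - j) c\<close> at the \<open>j\<close>-th shift of \<open>c\<close> and down by
\<open>N (n - j) d\<close> at the \<open>j\<close>-th shift of \<open>d\<close>, as long as these orbits have not left the interval from
\<open>c\<close> to \<open>d\<close>. Three linear relations between the generating functions at \<open>c\<close>, at \<open>d\<close> and of
the constant term follow, and eliminating two unknowns gives
\<open>(\<Sum>n. N n c * t ^ n) * K(t) = P(t)\<close> (\<open>knead_identity\<close>), where \<open>K\<close> and \<open>P\<close> are made of six power series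
whose coefficients are bounded by \<open>m\<close>, and \<open>K(0) = 1\<close>.

By compactness, along a subsequence the coefficients for \<open>(c\<^sub>k, d\<^sub>k)\<close> converge, so that \<open>K\<^sub>k\<close>
converges to an analytic function which is not identically zero because its value at \<open>0\<close> is \<open>1\<close>.
The coefficients as such may jump when \<open>c\<close> or \<open>d\<close> is periodic or when their orbits meet; passing to a
subsequence treats all these cases alike, because only the value at \<open>0\<close> matters. If the dimensions for all \<open>(c\<^sub>k, d\<^sub>k)\<close> are below \<open>s\<close>,
the generating functions converge for \<open>t < (m + 1) powr - s\<close>; choosing \<open>t\<close> close to this bound
outside the discrete zero set of the limit makes the sums bounded uniformly in \<open>k\<close>. Since every
word that is admissible for \<open>(c, d)\<close> is admissible for \<open>(c\<^sub>k, d\<^sub>k)\<close> when \<open>k\<close> is large,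
\<open>N n c * t ^ n\<close> is bounded for \<open>(c, d)\<close> itself. This bounds the dimension
(\<open>hausdorff_null_if_word_count_bound\<close>): a sequence whose orbit hits \<open>c\<close> or \<open>d\<close> belongs to a
countable set, and a prefix of any other one splits as an admissible word in front of \<open>c\<close> followed
by a prefix of \<open>c\<close>.\<close>

section \<open>Lexicographic order on sequences\<close>

notation less_fun (infix \<open>\<sqsubset>\<close> 50)
notation lex_le (infix \<open>\<sqsubseteq>\<close> 50)

lemma lex_total: "x \<sqsubset> y \<or> x = y \<or> y \<sqsubset> (x :: nat \<Rightarrow> nat)"
proof (cases "x = y")
  case False
  then obtain i where "x i \<noteq> y i" by blast
  define k where "k = (LEAST i. x i \<noteq> y i)"
  have "x k \<noteq> y k" "\<And>i. i < k \<Longrightarrow> x i = y i"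
    unfolding k_def using \<open>x i \<noteq> y i\<close> by (metis (mono_tags, lifting) LeastI) (use not_less_Least in blast)
  then show ?thesis
    unfolding less_fun_def by (metis linorder_neqE_nat)
qed simp

lemma not_lex_less_iff: "\<not> x \<sqsubset> y \<longleftrightarrow> y \<sqsubseteq> x"
  unfolding lex_le_def using lex_total less_fun_asym less_fun_irrefl by metis

lemma not_lex_le_iff: "\<not> x \<sqsubseteq> y \<longleftrightarrow> y \<sqsubset> x"
  using not_lex_less_iff by metis

lemma lex_le_refl [simp]: "x \<sqsubseteq> x"
  by (simp add: lex_le_def)

lemma lex_less_imp_le: "x \<sqsubset> y \<Longrightarrow> x \<sqsubseteq> y"
  by (simp add: lex_le_def)

lemma lex_le_less_trans: "x \<sqsubseteq> y \<Longrightarrow> y \<sqsubset> z \<Longrightarrow> x \<sqsubset> z"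
  unfolding lex_le_def using less_fun_trans by metis

lemma lex_less_le_trans: "x \<sqsubset> y \<Longrightarrow> y \<sqsubseteq> z \<Longrightarrow> x \<sqsubset> z"
  unfolding lex_le_def using less_fun_trans by metis

lemma lex_le_trans: "x \<sqsubseteq> y \<Longrightarrow> y \<sqsubseteq> z \<Longrightarrow> x \<sqsubseteq> z"
  unfolding lex_le_def using less_fun_trans by metis

lemma shift_iterate: "(shift ^^ n) x = suffix n x"
  by (induction n) (simp_all add: shift_def fun_eq_iff)

text \<open>A strict inequality is decided at the first difference, hence it survives changes far out. In this form the order enters the approximation of \<open>c\<close> and \<open>d\<close>
by sequences with long common prefixes.\<close>

lemma lex_less_stable:
  fixes x y :: "nat \<Rightarrow> nat"
  assumes "x \<sqsubset> y"
  obtains K where "\<And>x' y'. (\<forall>i<K. x' i = x i) \<Longrightarrow> (\<forall>i<K. y' i = y i) \<Longrightarrow> x' \<sqsubset> y'"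
proof -
  obtain k where "x k < y k" "\<And>i. i < k \<Longrightarrow> x i = y i"
    using assms unfolding less_fun_def by auto
  then have "x' \<sqsubset> y'" if "\<forall>i<Suc k. x' i = x i" "\<forall>i<Suc k. y' i = y i" for x' y'
    unfolding less_fun_def using that by (intro exI[of _ k]) auto
  then show thesis by (rule that)
qed

lemma lex_less_conc_iff:
  fixes x y :: "nat \<Rightarrow> nat"
  shows "v \<frown> x \<sqsubset> v \<frown> y \<longleftrightarrow> x \<sqsubset> y"
proof
  assume "v \<frown> x \<sqsubset> v \<frown> y"
  then obtain k where k: "(v \<frown> x) k < (v \<frown> y) k" "\<And>i. i < k \<Longrightarrow> (v \<frown> x) i = (v \<frown> y) i"
    unfolding less_fun_def by auto
  have "\<not> k < length v"
    using k(1) by auto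
  moreover have "x i = y i" if "i < k - length v" for i
    using k(2)[of "length v + i"] that by simp
  ultimately show "x \<sqsubset> y"
    unfolding less_fun_def using k(1) by (intro exI[of _ "k - length v"]) simp
next
  assume "x \<sqsubset> y"
  then obtain k where k: "x k < y k" "\<And>i. i < k \<Longrightarrow> x i = y i"
    unfolding less_fun_def by auto
  have "(v \<frown> x) i = (v \<frown> y) i" if "i < length v + k" for i
    using k(2)[of "i - length v"] that by (cases "i < length v") auto
  then show "v \<frown> x \<sqsubset> v \<frown> y"
    unfolding less_fun_def using k(1) by (intro exI[of _ "length v + k"]) simp
qed

lemma lex_le_conc_iff: "v \<frown> x \<sqsubseteq> v \<frown> y \<longleftrightarrow> x \<sqsubseteq> y"
  by (simp add: lex_le_def lex_less_conc_iff)

lemma lex_less_build_iff: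
  fixes e y :: "nat \<Rightarrow> nat"
  shows "e \<sqsubset> a ## y \<longleftrightarrow> e 0 < a \<or> e 0 = a \<and> suffix 1 e \<sqsubset> y"
proof -
  have e: "[e 0] \<frown> suffix 1 e = e"
    by (simp add: fun_eq_iff conc_def)
  consider "e 0 < a" | "e 0 = a" | "a < e 0" by linarith
  then show ?thesis
  proof cases
    case 2
    then show ?thesis
      using lex_less_conc_iff[of "[a]" "suffix 1 e" y] e by simp
  next
    case 3
    then have "a ## y \<sqsubset> e" unfolding less_fun_def by (intro exI[of _ 0]) simp
    with 3 show ?thesis using less_fun_asym by auto
  qed (auto simp: less_fun_def intro!: exI[of _ 0])
qed

lemma lex_le_build_iff: "e \<sqsubseteq> a ## y \<longleftrightarrow> e 0 < a \<or> e 0 = a \<and> suffix 1 e \<sqsubseteq> y"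
proof -
  have e: "e 0 ## suffix 1 e = e" by simp
  show ?thesis
    unfolding lex_le_def lex_less_build_iff using e build_eq by metis
qed

section \<open>Admissible words\<close>

text \<open>Both inequalities are strict and \<open>y\<close> itself is unconstrained. Strictness makes admissibility an
open condition, so it passes from \<open>(c, d)\<close> to all nearby pairs; it also makes the jumps of the count
exact even when the orbits of \<open>c\<close> and \<open>d\<close> are periodic or meet each other.\<close>

definition admissible :: "nat \<Rightarrow> (nat \<Rightarrow> nat) \<Rightarrow> (nat \<Rightarrow> nat) \<Rightarrow> nat \<Rightarrow> (nat \<Rightarrow> nat) \<Rightarrow> nat list set" where
  "admissible m c d n y = {v. length v = n \<and> set v \<subseteq> {..m} \<and>
     (\<forall>i<n. c \<sqsubset> suffix i (v \<frown> y) \<and> suffix i (v \<frown> y) \<sqsubset> d)}"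

definition word_count :: "nat \<Rightarrow> (nat \<Rightarrow> nat) \<Rightarrow> (nat \<Rightarrow> nat) \<Rightarrow> nat \<Rightarrow> (nat \<Rightarrow> nat) \<Rightarrow> real" where
  "word_count m c d n y = real (card (admissible m c d n y))"

lemma finite_words: "finite {v. length v = n \<and> set v \<subseteq> {..m::nat}}"
  using finite_lists_length_eq[of "{..m}" n] by (simp add: conj_commute)

lemma finite_admissible: "finite (admissible m c d n y)"
  by (rule finite_subset[OF _ finite_words[of n m]]) (auto simp: admissible_def)

lemma word_count_nonneg [simp]: "0 \<le> word_count m c d n y"
  by (simp add: word_count_def)

lemma word_count_0 [simp]: "word_count m c d 0 y = 1"
proof -
  have "admissible m c d 0 y = {[]}" by (auto simp: admissible_def)
  then show ?thesis by (simp add: word_count_def)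
qed

lemma admissible_Suc:
  "admissible m c d (Suc n) y =
    (\<Union>a\<in>{a. a \<le> m \<and> c \<sqsubset> a ## y \<and> a ## y \<sqsubset> d}. (\<lambda>v. v @ [a]) ` admissible m c d n (a ## y))"
  (is "?L = ?R")
proof (intro equalityI subsetI)
  fix w assume w: "w \<in> ?L"
  then have "length w = Suc n" by (simp add: admissible_def)
  then obtain v a where va: "w = v @ [a]" "length v = n"
    by (metis length_Suc_conv_rev)
  have *: "\<forall>i<Suc n. c \<sqsubset> suffix i (v \<frown> a ## y) \<and> suffix i (v \<frown> a ## y) \<sqsubset> d"
    using w va by (simp add: admissible_def)
  from *[rule_format, of n] have "c \<sqsubset> a ## y \<and> a ## y \<sqsubset> d"
    using va by simp
  with * w va show "w \<in> ?R"
    by (auto simp: admissible_def)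
next
  fix w assume "w \<in> ?R"
  then obtain v a where va: "w = v @ [a]" "a \<le> m" "c \<sqsubset> a ## y" "a ## y \<sqsubset> d"
      "v \<in> admissible m c d n (a ## y)" by blast
  then have "c \<sqsubset> suffix i (v \<frown> a ## y) \<and> suffix i (v \<frown> a ## y) \<sqsubset> d" if "i < Suc n" for i
    using that by (cases "i = n") (auto simp: admissible_def)
  then show "w \<in> ?L" using va by (auto simp: admissible_def)
qed

text \<open>Moving the last letter \<open>a\<close> of a word over to \<open>y\<close> leaves an admissible word in front of \<open>a ## y\<close>, so
the count is obtained by iterating a transfer operator in \<open>y\<close>.\<close>

lemma word_count_Suc:
  "word_count m c d (Suc n) y =
    (\<Sum>a\<le>m. of_bool (c \<sqsubset> a ## y \<and> a ## y \<sqsubset> d) * word_count m c d n (a ## y))"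
proof -
  let ?I = "{a. a \<le> m \<and> c \<sqsubset> a ## y \<and> a ## y \<sqsubset> d}"
  have fin: "finite ?I" by (rule finite_subset[of _ "{..m}"]) auto
  have "card (admissible m c d (Suc n) y) =
      (\<Sum>a\<in>?I. card ((\<lambda>v. v @ [a]) ` admissible m c d n (a ## y)))"
    unfolding admissible_Suc
    by (rule card_UN_disjoint) (use fin finite_admissible in auto)
  also have "\<dots> = (\<Sum>a\<in>?I. card (admissible m c d n (a ## y)))"
    by (intro sum.cong refl card_image inj_onI) simp
  finally have "word_count m c d (Suc n) y = (\<Sum>a\<in>?I. word_count m c d n (a ## y))"
    by (simp add: word_count_def)
  also have "\<dots> = (\<Sum>a\<le>m. of_bool (c \<sqsubset> a ## y \<and> a ## y \<sqsubset> d) * word_count m c d n (a ## y))"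
    by (rule sum.mono_neutral_cong_left) auto
  finally show ?thesis .
qed

section \<open>The kneading identity\<close>

lemma number_of_letters_above:
  assumes "e 0 \<le> m"
  shows "(\<Sum>a\<le>m. of_bool (e \<sqsubset> a ## y) :: real) = real m - real (e 0) + of_bool (suffix 1 e \<sqsubset> y)"
    and "(\<Sum>a\<le>m. of_bool (e \<sqsubseteq> a ## y) :: real) = real m - real (e 0) + of_bool (suffix 1 e \<sqsubseteq> y)"
proof -
  have *: "(\<Sum>a\<le>m. of_bool (e 0 < a \<or> e 0 = a \<and> P) :: real) = real m - real (e 0) + of_bool P" for P
  proof -
    have "(\<Sum>a\<le>m. of_bool (e 0 < a \<or> e 0 = a \<and> P) :: real) =
        (\<Sum>a\<le>m. of_bool (e 0 < a) + (if a = e 0 then of_bool P else 0))"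
      by (intro sum.cong) auto
    also have "\<dots> = (\<Sum>a\<le>m. of_bool (e 0 < a)) + of_bool P"
      using assms by (simp add: sum.distrib)
    also have "(\<Sum>a\<le>m. of_bool (e 0 < a) :: real) = (\<Sum>a\<in>{e 0<..m}. 1)"
      by (rule sum.mono_neutral_cong_right) auto
    also have "\<dots> = real m - real (e 0)"
      using assms by simp
    finally show ?thesis .
  qed
  show "(\<Sum>a\<le>m. of_bool (e \<sqsubset> a ## y) :: real) = real m - real (e 0) + of_bool (suffix 1 e \<sqsubset> y)"
    unfolding lex_less_build_iff by (rule *)
  show "(\<Sum>a\<le>m. of_bool (e \<sqsubseteq> a ## y) :: real) = real m - real (e 0) + of_bool (suffix 1 e \<sqsubseteq> y)"
    unfolding lex_le_build_iff by (rule *)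
qed

text \<open>The indices \<open>j\<close> at which the \<open>j\<close>-th shift of \<open>c\<close> is a jump of the count: if \<open>v\<close> is admissible
in front of \<open>c\<close>, then \<open>v\<close> followed by the first \<open>j\<close> letters of \<open>c\<close> becomes admissible in front of \<open>y\<close>
as \<open>y\<close> passes above the \<open>j\<close>-th shift of \<open>c\<close>, provided that the earlier shifts of \<open>c\<close> respect the
constraints. They may
return to \<open>c\<close> itself, since \<open>y\<close> lies above the jump.\<close>

definition low_alive :: "(nat \<Rightarrow> nat) \<Rightarrow> (nat \<Rightarrow> nat) \<Rightarrow> nat \<Rightarrow> real" where
  "low_alive c d j = of_bool (1 \<le> j \<and> (\<forall>i<j. c \<sqsubseteq> suffix i c \<and> suffix i c \<sqsubset> d))"

definition high_alive :: "(nat \<Rightarrow> nat) \<Rightarrow> (nat \<Rightarrow> nat) \<Rightarrow> nat \<Rightarrow> real" where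
  "high_alive c d j = of_bool (1 \<le> j \<and> (\<forall>i<j. c \<sqsubset> suffix i d \<and> suffix i d \<sqsubseteq> d))"

text \<open>The part of the number of letters \<open>a\<close> with \<open>a ## y\<close> above \<open>e\<close> and between \<open>c\<close> and \<open>d\<close> that does
not depend on \<open>y\<close>. Points \<open>e\<close> outside the interval are moved to the nearer end point.\<close>

definition low_digits :: "(nat \<Rightarrow> nat) \<Rightarrow> (nat \<Rightarrow> nat) \<Rightarrow> (nat \<Rightarrow> nat) \<Rightarrow> real" where
  "low_digits c d e = (if e \<sqsubset> c then real (d 0) - real (c 0)
     else if e \<sqsubset> d then real (d 0) - real (e 0) else 0)"

definition high_digits :: "(nat \<Rightarrow> nat) \<Rightarrow> (nat \<Rightarrow> nat) \<Rightarrow> (nat \<Rightarrow> nat) \<Rightarrow> real" where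
  "high_digits c d e = (if e \<sqsubseteq> c then real (d 0) - real (c 0)
     else if e \<sqsubseteq> d then real (d 0) - real (e 0) else 0)"

text \<open>The count is written as a constant, \<open>offset n\<close>, plus the jumps collected by \<open>orbit_sum n y\<close>.\<close>

locale kneading =
  fixes m :: nat and c d :: "nat \<Rightarrow> nat"
  assumes c_le: "\<And>i. c i \<le> m" and d_le: "\<And>i. d i \<le> m" and c_less_d: "c \<sqsubset> d"
begin

abbreviation "N \<equiv> word_count m c d"
abbreviation "\<alpha> \<equiv> low_alive c d"
abbreviation "\<beta> \<equiv> high_alive c d"
abbreviation "\<Delta> \<equiv> real (d 0) - real (c 0)"

definition orbit_sum :: "nat \<Rightarrow> (nat \<Rightarrow> nat) \<Rightarrow> real" where
  "orbit_sum n y = (\<Sum>j\<le>n. \<alpha> j * of_bool (suffix j c \<sqsubset> y) * N (n - j) c) -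
           (\<Sum>j\<le>n. \<beta> j * of_bool (suffix j d \<sqsubseteq> y) * N (n - j) d)"

definition offset :: "nat \<Rightarrow> real" where
  "offset n = N n c - orbit_sum n c"

lemma sum_interval:
  "(\<Sum>a\<le>m. of_bool (c \<sqsubset> a ## y \<and> a ## y \<sqsubset> d) :: real) =
    \<Delta> + of_bool (suffix 1 c \<sqsubset> y) - of_bool (suffix 1 d \<sqsubseteq> y)"
proof -
  have "of_bool (c \<sqsubset> x \<and> x \<sqsubset> d) = (of_bool (c \<sqsubset> x) - of_bool (d \<sqsubseteq> x) :: real)" for x
    using c_less_d lex_less_le_trans not_lex_less_iff by auto
  then show ?thesis
    by (simp add: sum_subtractf number_of_letters_above c_le d_le del: One_nat_def sum_of_bool_eq)
qed

text \<open>Jumps of the indicator of \<open>e \<sqsubset> x\<close>, restricted to the interval, under the transfer operator: the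
jump at \<open>e\<close> moves to the shift of \<open>e\<close>, and cutting at the interval ends produces jumps at the shifts of
\<open>c\<close> and \<open>d\<close>.\<close>

lemma sum_above_low:
  assumes e: "\<And>i. e i \<le> m"
  shows "(\<Sum>a\<le>m. of_bool (c \<sqsubset> a ## y \<and> a ## y \<sqsubset> d) * of_bool (e \<sqsubset> a ## y) :: real) =
    low_digits c d e + of_bool (c \<sqsubseteq> e \<and> e \<sqsubset> d) * of_bool (suffix 1 e \<sqsubset> y)
    + of_bool (e \<sqsubset> c) * of_bool (suffix 1 c \<sqsubset> y) - of_bool (e \<sqsubset> d) * of_bool (suffix 1 d \<sqsubseteq> y)"
proof -
  consider "e \<sqsubset> c" | "c \<sqsubseteq> e" "e \<sqsubset> d" | "d \<sqsubseteq> e"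
    using not_lex_less_iff by blast
  then show ?thesis
  proof cases
    case 1
    then have "e \<sqsubset> d" using c_less_d less_fun_trans by blast
    have "(\<Sum>a\<le>m. of_bool (c \<sqsubset> a ## y \<and> a ## y \<sqsubset> d) * of_bool (e \<sqsubset> a ## y) :: real) =
        (\<Sum>a\<le>m. of_bool (c \<sqsubset> a ## y \<and> a ## y \<sqsubset> d))"
      using 1 less_fun_trans by (intro sum.cong) auto
    then show ?thesis
      using 1 \<open>e \<sqsubset> d\<close> not_lex_le_iff by (simp add: sum_interval low_digits_def del: One_nat_def sum_of_bool_eq)
  next
    case 2
    have "of_bool (c \<sqsubset> x \<and> x \<sqsubset> d) * of_bool (e \<sqsubset> x) = (of_bool (e \<sqsubset> x) - of_bool (d \<sqsubseteq> x) :: real)" for x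
    proof -
      have "d \<sqsubseteq> x \<Longrightarrow> e \<sqsubset> x" using 2 lex_less_le_trans by blast
      moreover have "e \<sqsubset> x \<Longrightarrow> c \<sqsubset> x" using 2 lex_le_less_trans by blast
      ultimately show ?thesis using not_lex_le_iff[of d x] by auto
    qed
    then have "(\<Sum>a\<le>m. of_bool (c \<sqsubset> a ## y \<and> a ## y \<sqsubset> d) * of_bool (e \<sqsubset> a ## y) :: real) =
        real (d 0) - real (e 0) + of_bool (suffix 1 e \<sqsubset> y) - of_bool (suffix 1 d \<sqsubseteq> y)"
      by (simp add: sum_subtractf number_of_letters_above e d_le del: One_nat_def sum_of_bool_eq)
    moreover have "\<not> e \<sqsubset> c" using 2 not_lex_less_iff by blast
    ultimately show ?thesis
      using 2 by (simp add: low_digits_def del: One_nat_def)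
  next
    case 3
    then have "\<not> e \<sqsubset> d" "\<not> e \<sqsubset> c"
      using c_less_d not_lex_less_iff less_fun_trans by blast+
    moreover have "of_bool (c \<sqsubset> x \<and> x \<sqsubset> d) * of_bool (e \<sqsubset> x) = (0 :: real)" for x
      using 3 lex_le_less_trans less_fun_asym by fastforce
    ultimately show ?thesis by (simp add: low_digits_def)
  qed
qed

lemma sum_above_high:
  assumes e: "\<And>i. e i \<le> m"
  shows "(\<Sum>a\<le>m. of_bool (c \<sqsubset> a ## y \<and> a ## y \<sqsubset> d) * of_bool (e \<sqsubseteq> a ## y) :: real) =
    high_digits c d e + of_bool (c \<sqsubset> e \<and> e \<sqsubseteq> d) * of_bool (suffix 1 e \<sqsubseteq> y)
    + of_bool (e \<sqsubseteq> c) * of_bool (suffix 1 c \<sqsubset> y) - of_bool (e \<sqsubseteq> d) * of_bool (suffix 1 d \<sqsubseteq> y)"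
proof -
  consider "e \<sqsubseteq> c" | "c \<sqsubset> e" "e \<sqsubseteq> d" | "d \<sqsubset> e"
    using not_lex_less_iff by blast
  then show ?thesis
  proof cases
    case 1
    then have "e \<sqsubseteq> d" using c_less_d lex_le_trans lex_less_imp_le by blast
    have "(\<Sum>a\<le>m. of_bool (c \<sqsubset> a ## y \<and> a ## y \<sqsubset> d) * of_bool (e \<sqsubseteq> a ## y) :: real) =
        (\<Sum>a\<le>m. of_bool (c \<sqsubset> a ## y \<and> a ## y \<sqsubset> d))"
      using 1 lex_le_less_trans lex_less_imp_le by (intro sum.cong) auto
    then show ?thesis
      using 1 \<open>e \<sqsubseteq> d\<close> not_lex_less_iff by (simp add: sum_interval high_digits_def del: One_nat_def sum_of_bool_eq)
  next
    case 2
    have "of_bool (c \<sqsubset> x \<and> x \<sqsubset> d) * of_bool (e \<sqsubseteq> x) = (of_bool (e \<sqsubseteq> x) - of_bool (d \<sqsubseteq> x) :: real)" for x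
    proof -
      have "d \<sqsubseteq> x \<Longrightarrow> e \<sqsubseteq> x" using 2 lex_le_trans by blast
      moreover have "e \<sqsubseteq> x \<Longrightarrow> c \<sqsubset> x" using 2 lex_less_le_trans by blast
      ultimately show ?thesis using not_lex_le_iff[of d x] by auto
    qed
    then have "(\<Sum>a\<le>m. of_bool (c \<sqsubset> a ## y \<and> a ## y \<sqsubset> d) * of_bool (e \<sqsubseteq> a ## y) :: real) =
        real (d 0) - real (e 0) + of_bool (suffix 1 e \<sqsubseteq> y) - of_bool (suffix 1 d \<sqsubseteq> y)"
      by (simp add: sum_subtractf number_of_letters_above e d_le del: One_nat_def sum_of_bool_eq)
    moreover have "\<not> e \<sqsubseteq> c" using 2 not_lex_le_iff by blast
    ultimately show ?thesis
      using 2 by (simp add: high_digits_def del: One_nat_def)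
  next
    case 3
    then have "\<not> e \<sqsubseteq> d" "\<not> e \<sqsubseteq> c"
      using c_less_d not_lex_le_iff less_fun_trans by blast+
    moreover have "of_bool (c \<sqsubset> x \<and> x \<sqsubset> d) * of_bool (e \<sqsubseteq> x) = (0 :: real)" for x
      using 3 lex_le_less_trans less_fun_asym by fastforce
    ultimately show ?thesis by (simp add: high_digits_def)
  qed
qed

lemma low_alive_0 [simp]: "\<alpha> 0 = 0" and high_alive_0 [simp]: "\<beta> 0 = 0"
  by (simp_all add: low_alive_def high_alive_def)

lemma low_alive_Suc:
  "\<alpha> (Suc j) = of_bool (j = 0) + \<alpha> j * of_bool (c \<sqsubseteq> suffix j c \<and> suffix j c \<sqsubset> d)"
  using c_less_d by (auto simp: low_alive_def less_Suc_eq)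

lemma high_alive_Suc:
  "\<beta> (Suc j) = of_bool (j = 0) + \<beta> j * of_bool (c \<sqsubset> suffix j d \<and> suffix j d \<sqsubseteq> d)"
  using c_less_d by (auto simp: high_alive_def less_Suc_eq)

definition next_offset :: "nat \<Rightarrow> real" where
  "next_offset n = \<Delta> * offset n
     + (\<Sum>j\<le>n. \<alpha> j * low_digits c d (suffix j c) * N (n - j) c)
     - (\<Sum>j\<le>n. \<beta> j * high_digits c d (suffix j d) * N (n - j) d)"

lemma sum_orbit_low_Suc:
  "(\<Sum>j\<le>Suc n. \<alpha> j * of_bool (suffix j c \<sqsubset> y) * N (Suc n - j) c) =
    of_bool (suffix 1 c \<sqsubset> y) * N n c + (\<Sum>j\<le>n. \<alpha> j *
      (of_bool (c \<sqsubseteq> suffix j c \<and> suffix j c \<sqsubset> d) * of_bool (suffix 1 (suffix j c) \<sqsubset> y)) * N (n - j) c)"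
proof -
  have "(\<Sum>j\<le>Suc n. \<alpha> j * of_bool (suffix j c \<sqsubset> y) * N (Suc n - j) c) =
      (\<Sum>j\<le>n. \<alpha> (Suc j) * of_bool (suffix (Suc j) c \<sqsubset> y) * N (n - j) c)"
    by (subst sum.atMost_Suc_shift) simp
  also have "\<dots> = (\<Sum>j\<le>n. (if j = 0 then of_bool (suffix 1 c \<sqsubset> y) * N n c else 0) + \<alpha> j *
      (of_bool (c \<sqsubseteq> suffix j c \<and> suffix j c \<sqsubset> d) * of_bool (suffix 1 (suffix j c) \<sqsubset> y)) * N (n - j) c)"
    by (intro sum.cong refl) (simp add: low_alive_Suc algebra_simps)
  finally show ?thesis by (simp add: sum.distrib)
qed

lemma sum_orbit_high_Suc:
  "(\<Sum>j\<le>Suc n. \<beta> j * of_bool (suffix j d \<sqsubseteq> y) * N (Suc n - j) d) =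
    of_bool (suffix 1 d \<sqsubseteq> y) * N n d + (\<Sum>j\<le>n. \<beta> j *
      (of_bool (c \<sqsubset> suffix j d \<and> suffix j d \<sqsubseteq> d) * of_bool (suffix 1 (suffix j d) \<sqsubseteq> y)) * N (n - j) d)"
proof -
  have "(\<Sum>j\<le>Suc n. \<beta> j * of_bool (suffix j d \<sqsubseteq> y) * N (Suc n - j) d) =
      (\<Sum>j\<le>n. \<beta> (Suc j) * of_bool (suffix (Suc j) d \<sqsubseteq> y) * N (n - j) d)"
    by (subst sum.atMost_Suc_shift) simp
  also have "\<dots> = (\<Sum>j\<le>n. (if j = 0 then of_bool (suffix 1 d \<sqsubseteq> y) * N n d else 0) + \<beta> j *
      (of_bool (c \<sqsubset> suffix j d \<and> suffix j d \<sqsubseteq> d) * of_bool (suffix 1 (suffix j d) \<sqsubseteq> y)) * N (n - j) d)"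
    by (intro sum.cong refl) (simp add: high_alive_Suc algebra_simps)
  finally show ?thesis by (simp add: sum.distrib)
qed

text \<open>The transfer operator applied to constant plus jumps. The coefficient of the new jump at the first
shift of \<open>c\<close> adds up to the value of the count at \<open>c\<close> by the induction hypothesis, and likewise
for \<open>d\<close>; all other jumps move one step along the two orbits.\<close>

lemma word_count_step:
  assumes IH: "\<And>y. N n y = offset n + orbit_sum n y"
  shows "N (Suc n) y = next_offset n + orbit_sum (Suc n) y"
proof -
  let ?I = "\<lambda>a. of_bool (c \<sqsubset> a ## y \<and> a ## y \<sqsubset> d) :: real"
  let ?p = "of_bool (suffix 1 c \<sqsubset> y) :: real" and ?q = "of_bool (suffix 1 d \<sqsubseteq> y) :: real"
  let ?T = "\<lambda>j. low_digits c d (suffix j c)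
      + of_bool (c \<sqsubseteq> suffix j c \<and> suffix j c \<sqsubset> d) * of_bool (suffix 1 (suffix j c) \<sqsubset> y)
      + of_bool (suffix j c \<sqsubset> c) * ?p - of_bool (suffix j c \<sqsubset> d) * ?q"
  let ?U = "\<lambda>j. high_digits c d (suffix j d)
      + of_bool (c \<sqsubset> suffix j d \<and> suffix j d \<sqsubseteq> d) * of_bool (suffix 1 (suffix j d) \<sqsubseteq> y)
      + of_bool (suffix j d \<sqsubseteq> c) * ?p - of_bool (suffix j d \<sqsubseteq> d) * ?q"
  have "N (Suc n) y = (\<Sum>a\<le>m. ?I a * (offset n + orbit_sum n (a ## y)))"
    unfolding word_count_Suc IH[symmetric] ..
  also have "\<dots> = offset n * (\<Sum>a\<le>m. ?I a)
      + (\<Sum>a\<le>m. \<Sum>j\<le>n. \<alpha> j * N (n - j) c * (?I a * of_bool (suffix j c \<sqsubset> a ## y)))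
      - (\<Sum>a\<le>m. \<Sum>j\<le>n. \<beta> j * N (n - j) d * (?I a * of_bool (suffix j d \<sqsubseteq> a ## y)))"
    unfolding orbit_sum_def by (simp add: algebra_simps sum.distrib sum_subtractf sum_distrib_left)
  also have "\<dots> = offset n * (\<Sum>a\<le>m. ?I a)
      + (\<Sum>j\<le>n. \<alpha> j * N (n - j) c * (\<Sum>a\<le>m. ?I a * of_bool (suffix j c \<sqsubset> a ## y)))
      - (\<Sum>j\<le>n. \<beta> j * N (n - j) d * (\<Sum>a\<le>m. ?I a * of_bool (suffix j d \<sqsubseteq> a ## y)))"
    unfolding sum_distrib_left by (subst (1 2) sum.swap) (rule refl)
  also have "\<dots> = offset n * (\<Delta> + ?p - ?q) + (\<Sum>j\<le>n. \<alpha> j * N (n - j) c * ?T j)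
      - (\<Sum>j\<le>n. \<beta> j * N (n - j) d * ?U j)"
    by (simp only: sum_interval sum_above_low[of "suffix _ c"] sum_above_high[of "suffix _ d"]
        suffix_nth c_le d_le)
  also have "\<dots> = next_offset n + ?p * (offset n + orbit_sum n c) - ?q * (offset n + orbit_sum n d)
      + (\<Sum>j\<le>n. \<alpha> j * (of_bool (c \<sqsubseteq> suffix j c \<and> suffix j c \<sqsubset> d)
           * of_bool (suffix 1 (suffix j c) \<sqsubset> y)) * N (n - j) c)
      - (\<Sum>j\<le>n. \<beta> j * (of_bool (c \<sqsubset> suffix j d \<and> suffix j d \<sqsubseteq> d)
           * of_bool (suffix 1 (suffix j d) \<sqsubseteq> y)) * N (n - j) d)"
    unfolding orbit_sum_def next_offset_def
    by (simp add: algebra_simps sum.distrib sum_subtractf sum_distrib_left del: One_nat_def of_bool_conj suffix_suffix)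
  also have "\<dots> = next_offset n + orbit_sum (Suc n) y"
    unfolding IH[symmetric] orbit_sum_def[of "Suc n"] sum_orbit_low_Suc sum_orbit_high_Suc by simp
  finally show ?thesis .
qed

lemma word_count_eq: "N n y = offset n + orbit_sum n y"
  and offset_Suc: "offset (Suc n) = next_offset n"
proof -
  have *: "\<forall>y. N n y = offset n + orbit_sum n y" for n
  proof (induction n)
    case 0
    then show ?case by (simp add: offset_def orbit_sum_def)
  next
    case (Suc n)
    then have "N (Suc n) y = next_offset n + orbit_sum (Suc n) y" for y by (intro word_count_step) blast
    then show ?case unfolding offset_def by (metis add.commute add_diff_cancel)
  qed
  then show "N n y = offset n + orbit_sum n y" by blast
  have "N (Suc n) c = next_offset n + orbit_sum (Suc n) c" by (intro word_count_step) (use * in blast)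
  then show "offset (Suc n) = next_offset n" by (simp add: offset_def)
qed

lemma offset_0: "offset 0 = 1"
  by (simp add: offset_def orbit_sum_def)

end

section \<open>The kneading determinant\<close>

text \<open>Row \<open>r\<close>, entry \<open>j\<close>. Rows 0 and 1 are the jumps seen at \<open>c\<close>, rows 2 and 3 the jumps seen at \<open>d\<close>, rows
4 and 5 the contributions of the jumps to the next constant term. They are kept in one family over a
countable index type so that a single compactness argument applies to all of them.\<close>

definition knead_coeff :: "(nat \<Rightarrow> nat) \<Rightarrow> (nat \<Rightarrow> nat) \<Rightarrow> nat \<times> nat \<Rightarrow> real" where
  "knead_coeff c d = (\<lambda>(r, j).
     if r = 0 then low_alive c d j * of_bool (suffix j c \<sqsubset> c)
     else if r = 1 then high_alive c d j * of_bool (suffix j d \<sqsubseteq> c)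
     else if r = 2 then low_alive c d j * of_bool (suffix j c \<sqsubset> d)
     else if r = 3 then high_alive c d j * of_bool (suffix j d \<sqsubseteq> d)
     else if r = 4 then low_alive c d j * low_digits c d (suffix j c)
     else if r = 5 then high_alive c d j * high_digits c d (suffix j d)
     else 0)"

definition row_series :: "(nat \<times> nat \<Rightarrow> real) \<Rightarrow> nat \<Rightarrow> 'a \<Rightarrow> 'a :: {banach, real_normed_field}" where
  "row_series g r t = (\<Sum>j. of_real (g (r, j)) * t ^ j)"

definition knead_num :: "(nat \<times> nat \<Rightarrow> real) \<Rightarrow> 'a \<Rightarrow> 'a :: {banach, real_normed_field}" where
  "knead_num g t = 1 + row_series g 3 t - row_series g 1 t"

text \<open>With \<open>A\<close>, \<open>B\<close>, \<open>Z\<close> the generating functions of the count at \<open>c\<close>, at \<open>d\<close> and of the constant term, and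
\<open>e\<^sub>r\<close> the row series, the relations are \<open>Z = A * (1 - e\<^sub>0) + B * e\<^sub>1\<close>, \<open>B = Z + A * e\<^sub>2 - B * e\<^sub>3\<close> and
\<open>Z = 1 + t * (\<Delta> * Z + A * e\<^sub>4 - B * e\<^sub>5)\<close>. The first two give \<open>B * P = A * (1 - e\<^sub>0 + e\<^sub>2)\<close>
with \<open>P = 1 + e\<^sub>3 - e\<^sub>1\<close>, the value of \<open>knead_num\<close>; inserting this into \<open>P\<close> times the third one leaves \<open>A\<close>
times the determinant on one side and \<open>P\<close> on the other. It is defined over real and over complex arguments: estimates live on
the real line, the isolation of zeros in the complex disc.\<close>

definition knead_det :: "(nat \<times> nat \<Rightarrow> real) \<Rightarrow> real \<Rightarrow> 'a \<Rightarrow> 'a :: {banach, real_normed_field}" where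
  "knead_det g \<Delta> t =
     (knead_num g t * (1 - row_series g 0 t) + (1 - row_series g 0 t + row_series g 2 t) * row_series g 1 t) * (1 - of_real \<Delta> * t)
     - knead_num g t * t * row_series g 4 t + (1 - row_series g 0 t + row_series g 2 t) * t * row_series g 5 t"

lemma convolution_series:
  fixes f g :: "nat \<Rightarrow> real"
  assumes f: "summable (\<lambda>n. f n * t ^ n)" "\<And>n. 0 \<le> f n"
    and g: "\<And>j. \<bar>g j\<bar> \<le> M" and t: "0 \<le> t" "t < 1"
  shows "(\<lambda>n. (\<Sum>j\<le>n. g j * f (n - j)) * t ^ n) sums ((\<Sum>j. g j * t ^ j) * (\<Sum>n. f n * t ^ n))"
proof -
  have sg: "summable (\<lambda>j. norm (g j * t ^ j))"
  proof (rule summable_comparison_test')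
    show "summable (\<lambda>j. M * t ^ j)" using t by (intro summable_mult summable_geometric) auto
    show "norm (norm (g j * t ^ j)) \<le> M * t ^ j" if "j \<ge> 0" for j
      using g[of j] t by (simp add: abs_mult mult_right_mono)
  qed
  have sf: "summable (\<lambda>n. norm (f n * t ^ n))"
    using f t by (simp add: abs_mult)
  have "(\<lambda>n. \<Sum>j\<le>n. (g j * t ^ j) * (f (n - j) * t ^ (n - j))) sums
      ((\<Sum>j. g j * t ^ j) * (\<Sum>n. f n * t ^ n))"
    by (rule Cauchy_product_sums[OF sg sf])
  moreover have "(\<Sum>j\<le>n. (g j * t ^ j) * (f (n - j) * t ^ (n - j))) = (\<Sum>j\<le>n. g j * f (n - j)) * t ^ n" for n
    unfolding sum_distrib_right
  proof (intro sum.cong refl)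
    fix j assume "j \<in> {..n}"
    then have "t ^ j * t ^ (n - j) = t ^ n" by (simp flip: power_add)
    then show "g j * t ^ j * (f (n - j) * t ^ (n - j)) = g j * f (n - j) * t ^ n"
      by (metis mult.assoc mult.left_commute)
  qed
  ultimately show ?thesis by simp
qed

lemma low_digits_bound:
  assumes "\<And>i. c i \<le> m" "\<And>i. d i \<le> m" "\<And>i. e i \<le> m"
  shows "\<bar>low_digits c d e\<bar> \<le> real m" "\<bar>high_digits c d e\<bar> \<le> real m"
  using assms[of 0] by (auto simp: low_digits_def high_digits_def abs_if)

lemma knead_coeff_bound:
  assumes "\<And>i. c i \<le> m" "\<And>i. d i \<le> m" "1 \<le> m"
  shows "\<bar>knead_coeff c d p\<bar> \<le> real m"
proof -
  have "\<bar>low_digits c d (suffix j c)\<bar> \<le> real m" "\<bar>high_digits c d (suffix j d)\<bar> \<le> real m" for j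
    using assms by (intro low_digits_bound; simp)+
  moreover have "\<bar>low_alive c d j * x\<bar> \<le> real m" "\<bar>high_alive c d j * x\<bar> \<le> real m"
    if "\<bar>x\<bar> \<le> real m" for j x
    using that by (simp_all add: low_alive_def high_alive_def)
  moreover have "\<bar>of_bool P\<bar> \<le> real m" for P using assms(3) by simp
  ultimately show ?thesis
    by (cases p) (simp add: knead_coeff_def)
qed

lemma knead_coeff_0 [simp]: "knead_coeff c d (r, 0) = 0"
  by (simp add: knead_coeff_def low_alive_def high_alive_def)

lemma row_series_summable:
  fixes t :: "'a :: {banach, real_normed_field}"
  assumes "\<And>p. \<bar>g p\<bar> \<le> M" "norm t < 1"
  shows "summable (\<lambda>j. of_real (g (r, j)) * t ^ j)"
proof (rule summable_comparison_test')
  show "summable (\<lambda>j. M * norm t ^ j)" using assms by (intro summable_mult summable_geometric) auto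
  show "norm (of_real (g (r, j)) * t ^ j) \<le> M * norm t ^ j" if "j \<ge> 0" for j
    using assms(1) by (simp add: norm_mult norm_power mult_right_mono)
qed

lemma row_series_of_real:
  fixes t :: real
  assumes "\<And>p. \<bar>g p\<bar> \<le> M" "\<bar>t\<bar> < 1"
  shows "row_series g r (of_real t :: complex) = of_real (row_series g r t)"
  using suminf_of_real[OF row_series_summable[of g M t r], where 'a = complex] assms
  by (simp add: row_series_def)

lemma knead_det_of_real:
  fixes t :: real
  assumes "\<And>p. \<bar>g p\<bar> \<le> M" "\<bar>t\<bar> < 1"
  shows "knead_det g \<Delta> (of_real t :: complex) = of_real (knead_det g \<Delta> t)"
  unfolding knead_det_def knead_num_def row_series_of_real[OF assms] by simp

lemma row_series_holomorphic:
  assumes "\<And>p. \<bar>g p\<bar> \<le> M"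
  shows "row_series g r holomorphic_on ball 0 1"
proof (rule power_series_holomorphic)
  fix w :: complex assume "w \<in> ball 0 1"
  then have "summable (\<lambda>j. of_real (g (r, j)) * w ^ j)"
    using row_series_summable[of g M w r] assms by simp
  then show "(\<lambda>j. of_real (g (r, j)) * (w - 0) ^ j) sums row_series g r w"
    by (simp add: row_series_def summable_sums)
qed

lemma row_series_at_0: "g (r, 0) = 0 \<Longrightarrow> row_series g r 0 = 0"
  unfolding row_series_def by (subst powser_zero) simp

text \<open>The determinant is holomorphic on the unit disc and equals \<open>1\<close> at \<open>0\<close>, so its zeros cannot fill an
interval.\<close>

lemma knead_det_nonzero:
  assumes g: "\<And>p. \<bar>g p\<bar> \<le> M" and g0: "\<And>r. g (r, 0) = 0" and ab: "0 < a" "a < b" "b \<le> 1"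
  obtains t :: real where "a < t" "t < b" "knead_det g \<Delta> t \<noteq> 0"
proof (rule ccontr)
  assume "\<not> thesis"
  with that have zero: "knead_det g \<Delta> t = 0" if "a < t" "t < b" for t :: real
    using that by blast
  let ?f = "knead_det g \<Delta> :: complex \<Rightarrow> complex"
  let ?U = "of_real ` {a<..<b} :: complex set"
  \<comment> \<open>The midpoint is the accumulation point required by the identity theorem.\<close>
  define x\<^sub>0 where "x\<^sub>0 = (a + b) / 2"
  have x\<^sub>0: "0 < x\<^sub>0" "x\<^sub>0 < 1" using ab by (auto simp: x\<^sub>0_def)
  let ?\<xi> = "of_real x\<^sub>0 :: complex"
  have "?f 0 = 0"
  proof (rule analytic_continuation[of ?f "ball 0 1" ?U ?\<xi>])
    show "?f holomorphic_on ball 0 1"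
      unfolding knead_det_def knead_num_def
      by (intro holomorphic_intros row_series_holomorphic[OF g])
    show "?U \<subseteq> ball 0 1" "?\<xi> \<in> ball 0 1"
      using ab x\<^sub>0 by (auto simp: norm_of_real)
    show "?\<xi> islimpt ?U"
      unfolding islimpt_approachable
    proof (intro allI impI)
      fix e :: real assume e: "0 < e"
      define x where "x = x\<^sub>0 + min (e / 2) ((b - a) / 4)"
      have "x \<in> {a<..<b}" "x \<noteq> x\<^sub>0" "\<bar>x - x\<^sub>0\<bar> < e"
        using ab e unfolding x_def x\<^sub>0_def by (auto simp: min_def field_simps)
      then show "\<exists>x'\<in>?U. x' \<noteq> ?\<xi> \<and> dist x' ?\<xi> < e"
        by (intro bexI[of _ "of_real x"]) (simp_all only: of_real_eq_iff dist_of_real dist_real_def imageI not_False_eq_True simp_thms)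
    qed
    show "?f w = 0" if w: "w \<in> ?U" for w
    proof -
      obtain x where x: "w = of_real x" "a < x" "x < b" using w by auto
      then have "?f w = of_real (knead_det g \<Delta> x)"
        using ab by (simp add: knead_det_of_real[OF g])
      then show ?thesis using zero x by simp
    qed
  qed auto
  moreover have "?f 0 = 1"
    by (simp add: knead_det_def knead_num_def row_series_at_0 g0)
  ultimately show False by simp
qed

lemma row_series_tendsto:
  fixes t :: real
  assumes g: "\<And>k p. \<bar>g k p\<bar> \<le> M" and lim: "\<And>p. (\<lambda>k. g k p) \<longlonglongrightarrow> h p" and t: "\<bar>t\<bar> < 1"
  shows "(\<lambda>k. row_series (g k) r t) \<longlonglongrightarrow> row_series h r t"
proof -
  have "summable (\<lambda>j. M * \<bar>t\<bar> ^ j)" using t by (intro summable_mult summable_geometric) auto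
  moreover have "(\<lambda>k. g k (r, j) * t ^ j) \<longlonglongrightarrow> h (r, j) * t ^ j" for j
    by (intro tendsto_intros lim)
  moreover have "\<forall>\<^sub>F (j, k) in at_top \<times>\<^sub>F sequentially. norm (g k (r, j) * t ^ j) \<le> M * \<bar>t\<bar> ^ j"
    using g by (intro always_eventually) (auto simp: abs_mult power_abs mult_right_mono)
  ultimately show ?thesis
    using tannerys_theorem[of "\<lambda>j k. g k (r, j) * t ^ j" "\<lambda>j. h (r, j) * t ^ j" sequentially "\<lambda>j. M * \<bar>t\<bar> ^ j"]
    by (simp add: row_series_def)
qed

lemma knead_det_tendsto:
  fixes t :: real
  assumes g: "\<And>k p. \<bar>g k p\<bar> \<le> M" and lim: "\<And>p. (\<lambda>k. g k p) \<longlonglongrightarrow> h p" and t: "\<bar>t\<bar> < 1"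
  shows "(\<lambda>k. knead_num (g k) t) \<longlonglongrightarrow> knead_num h t"
    and "(\<lambda>k. knead_det (g k) \<Delta> t) \<longlonglongrightarrow> knead_det h \<Delta> t"
  unfolding knead_det_def knead_num_def by (intro tendsto_intros row_series_tendsto[OF assms])+

context kneading
begin

text \<open>The three relations are the formula for the count at \<open>c\<close>, the formula at \<open>d\<close>, and the recursion for the
constant term; sums along the orbits are convolutions and turn into products of series.\<close>

lemma knead_identity:
  fixes t :: real
  assumes m: "1 \<le> m" and t: "0 \<le> t" "t < 1"
    and sc: "summable (\<lambda>n. N n c * t ^ n)" and sd: "summable (\<lambda>n. N n d * t ^ n)"
  shows "(\<Sum>n. N n c * t ^ n) * knead_det (knead_coeff c d) \<Delta> t = knead_num (knead_coeff c d) t"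
proof -
  let ?e = "\<lambda>r. row_series (knead_coeff c d) r t"
  define A where "A = (\<Sum>n. N n c * t ^ n)"
  define B where "B = (\<Sum>n. N n d * t ^ n)"
  have conv: "(\<lambda>n. (\<Sum>j\<le>n. knead_coeff c d (r, j) * N (n - j) c) * t ^ n) sums (?e r * A)"
     "(\<lambda>n. (\<Sum>j\<le>n. knead_coeff c d (r, j) * N (n - j) d) * t ^ n) sums (?e r * B)" for r
    using convolution_series[OF sc _ _ t, of "\<lambda>j. knead_coeff c d (r, j)" "real m"]
      convolution_series[OF sd _ _ t, of "\<lambda>j. knead_coeff c d (r, j)" "real m"]
      knead_coeff_bound[OF c_le d_le m]
    by (simp_all add: A_def B_def row_series_def)
  have Sc: "(\<lambda>n. orbit_sum n c * t ^ n) sums (?e 0 * A - ?e 1 * B)"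
    using sums_diff[OF conv(1)[of 0] conv(2)[of 1]]
    by (simp add: orbit_sum_def knead_coeff_def left_diff_distrib)
  have Sd: "(\<lambda>n. orbit_sum n d * t ^ n) sums (?e 2 * A - ?e 3 * B)"
    using sums_diff[OF conv(1)[of 2] conv(2)[of 3]]
    by (simp add: orbit_sum_def knead_coeff_def left_diff_distrib)
  define Z where "Z = A - (?e 0 * A - ?e 1 * B)"
  have z: "(\<lambda>n. offset n * t ^ n) sums Z"
    using sums_diff[OF summable_sums[OF sc] Sc] by (simp add: Z_def A_def offset_def left_diff_distrib)
  have "(\<lambda>n. N n d * t ^ n) sums (Z + (?e 2 * A - ?e 3 * B))"
    using sums_add[OF z Sd] by (simp add: word_count_eq[of _ d] distrib_right)
  then have eqB: "B = Z + (?e 2 * A - ?e 3 * B)"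
    using sums_unique B_def by metis
  have "(\<lambda>n. next_offset n * t ^ n) sums (\<Delta> * Z + ?e 4 * A - ?e 5 * B)"
    using sums_diff[OF sums_add[OF sums_mult[OF z, of \<Delta>] conv(1)[of 4]] conv(2)[of 5]]
    by (simp add: next_offset_def knead_coeff_def algebra_simps)
  then have "(\<lambda>n. offset (Suc n) * t ^ Suc n) sums (t * (\<Delta> * Z + ?e 4 * A - ?e 5 * B))"
    using sums_mult[of _ _ t] by (fastforce simp: offset_Suc mult_ac)
  moreover have "(\<lambda>n. offset (Suc n) * t ^ Suc n) sums (Z - 1)"
    using z by (subst sums_Suc_iff) (simp add: offset_0)
  ultimately have eqZ: "Z - 1 = t * (\<Delta> * Z + ?e 4 * A - ?e 5 * B)"
    using sums_unique2 by blast
  define P where "P = 1 + ?e 3 - ?e 1"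
  define Q where "Q = 1 - ?e 0 + ?e 2"
  have BP: "B * P = A * Q"
    using eqB unfolding Z_def P_def Q_def by (simp add: algebra_simps)
  have "P = P * (Z * (1 - \<Delta> * t) - t * ?e 4 * A + t * ?e 5 * B)"
    using eqZ by (simp add: algebra_simps)
  also have "\<dots> = (P * A * (1 - ?e 0) + (B * P) * ?e 1) * (1 - \<Delta> * t) - P * t * ?e 4 * A + t * ?e 5 * (B * P)"
    unfolding Z_def by (simp add: algebra_simps)
  also have "\<dots> = A * ((P * (1 - ?e 0) + Q * ?e 1) * (1 - \<Delta> * t) - P * t * ?e 4 + Q * t * ?e 5)"
    unfolding BP by (simp add: algebra_simps)
  finally show ?thesis
    unfolding A_def[symmetric] knead_det_def knead_num_def P_def Q_def by simp
qed

end

section \<open>Hausdorff null sets and cylinders\<close>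

lemma prefix_eq_iff: "prefix n x = prefix n y \<longleftrightarrow> (\<forall>i<n. x i = y i)"
  by (auto simp: subsequence_def)

lemma ediam_le:
  "(\<And>x y. x \<in> U \<Longrightarrow> y \<in> U \<Longrightarrow> mdist X x y \<le> r) \<Longrightarrow> ediam X U \<le> ennreal r"
  unfolding ediam_def by (intro SUP_least ennreal_leI)

lemma mdist_le_ediam:
  assumes "x \<in> U" "y \<in> U" "ediam X U < top"
  shows "mdist X x y \<le> enn2real (ediam X U)"
proof -
  have "ennreal (mdist X x y) \<le> ediam X U"
    unfolding ediam_def using assms by (intro SUP_upper2[of x] SUP_upper2[of y]) auto
  also have "\<dots> = ennreal (enn2real (ediam X U))" using assms by simp
  finally show ?thesis by simp
qed

lemma diam_pow_finite: "diam_pow X s U = ennreal (enn2real (diam_pow X s U))"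
  unfolding diam_pow_def by simp

lemma powr_cylinder:
  "b > (0::real) \<Longrightarrow> (1 / b ^ l) powr s = (b powr - s) ^ l"
  by (simp add: powr_minus powr_divide inverse_eq_divide power_divide flip: powr_realpow)
     (simp add: powr_powr mult.commute)

lemma hausdorff_premeasure_eq_0:
  assumes "hausdorff_measure X s A = 0" "0 < \<delta>"
  shows "hausdorff_premeasure X s \<delta> A = 0"
proof -
  have "hausdorff_premeasure X s \<delta> A \<le> hausdorff_measure X s A"
    unfolding hausdorff_measure_def using assms(2) by (intro SUP_upper) auto
  then show ?thesis using assms(1) by simp
qed

lemma hausdorff_measure_eq_0I:
  assumes "\<And>\<delta> \<epsilon>. 0 < \<delta> \<Longrightarrow> 0 < \<epsilon> \<Longrightarrow> hausdorff_premeasure X s \<delta> A \<le> ennreal \<epsilon>"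
  shows "hausdorff_measure X s A = 0"
proof -
  have "hausdorff_premeasure X s \<delta> A \<le> 0" if "0 < \<delta>" for \<delta>
    by (rule ennreal_le_epsilon) (use assms[OF that] in simp)
  then have "hausdorff_measure X s A \<le> 0"
    unfolding hausdorff_measure_def by (intro SUP_least) simp
  then show ?thesis by simp
qed

lemma hausdorff_measure_mono_exponent:
  assumes null: "hausdorff_measure X s A = 0" and s: "0 \<le> s" "s \<le> s'"
  shows "hausdorff_measure X s' A = 0"
proof (rule hausdorff_measure_eq_0I)
  fix \<delta> \<epsilon> :: real assume \<delta>: "0 < \<delta>" and \<epsilon>: "0 < \<epsilon>"
  have "hausdorff_premeasure X s (min \<delta> 1) A < ennreal \<epsilon>"
    using hausdorff_premeasure_eq_0[OF null, of "min \<delta> 1"] \<delta> \<epsilon> by simp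
  then obtain U where U: "A \<subseteq> (\<Union>n. U n)" "\<And>n. U n \<subseteq> mspace X" "\<And>n. ediam X (U n) \<le> ennreal (min \<delta> 1)"
      "(\<Sum>n. diam_pow X s (U n)) < ennreal \<epsilon>"
    unfolding hausdorff_premeasure_def INF_less_iff by (auto simp: image_iff)
  have le: "diam_pow X s' (U n) \<le> diam_pow X s (U n)" for n
  proof -
    have "enn2real (ediam X (U n)) \<le> 1"
      using U(3)[of n] by (intro enn2real_leI) (auto intro: order_trans simp: min_def split: if_splits)
    then have "enn2real (ediam X (U n)) powr s' \<le> enn2real (ediam X (U n)) powr s"
      using s by (intro powr_mono') auto
    moreover have "enn2real (ediam X (U n)) powr s' \<le> 1"
      using \<open>_ \<le> 1\<close> s by (intro powr_le1) auto
    ultimately show ?thesis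
      using s by (auto simp: diam_pow_def intro: ennreal_leI)
  qed
  have "hausdorff_premeasure X s' \<delta> A \<le> (\<Sum>n. diam_pow X s' (U n))"
    unfolding hausdorff_premeasure_def
  proof (intro INF_lower CollectI conjI allI)
    show "ediam X (U n) \<le> ennreal \<delta>" for n
      by (rule order_trans[OF U(3)]) (simp add: ennreal_leI)
  qed (use U in auto)
  also have "\<dots> \<le> (\<Sum>n. diam_pow X s (U n))"
    by (intro suminf_le le) auto
  finally show "hausdorff_premeasure X s' \<delta> A \<le> ennreal \<epsilon>" using U(4) by simp
qed

lemma hausdorff_measure_eq_0_if_dim_less:
  assumes "hausdorff_dim X A < ennreal s"
  shows "hausdorff_measure X s A = 0"
proof -
  obtain s' where "0 \<le> s'" "hausdorff_measure X s' A = 0" "ennreal s' < ennreal s"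
    using assms unfolding hausdorff_dim_def INF_less_iff by auto
  moreover then have "s' \<le> s" by (metis ennreal_leI linorder_not_le nle_le)
  ultimately show ?thesis using hausdorff_measure_mono_exponent by blast
qed

lemma hausdorff_dim_leI:
  assumes "0 \<le> s" "\<And>s'. s < s' \<Longrightarrow> hausdorff_measure X s' A = 0"
  shows "hausdorff_dim X A \<le> ennreal s"
proof (rule ennreal_le_epsilon)
  fix e :: real assume "0 < e"
  then have "hausdorff_dim X A \<le> ennreal (s + e)"
    unfolding hausdorff_dim_def using assms by (intro INF_lower) auto
  then show "hausdorff_dim X A \<le> ennreal s + ennreal e"
    using assms \<open>0 < e\<close> by simp
qed

lemma hausdorff_null_mono:
  assumes "hausdorff_measure X s B = 0" "A \<subseteq> B"
  shows "hausdorff_measure X s A = 0"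
proof -
  have "hausdorff_premeasure X s \<delta> A \<le> hausdorff_premeasure X s \<delta> B" for \<delta>
    unfolding hausdorff_premeasure_def using assms(2) by (intro INF_superset_mono) auto
  then have "hausdorff_measure X s A \<le> hausdorff_measure X s B"
    unfolding hausdorff_measure_def by (intro SUP_mono) auto
  then show ?thesis using assms(1) by simp
qed

lemma hausdorff_dim_mono:
  assumes "A \<subseteq> B"
  shows "hausdorff_dim X A \<le> hausdorff_dim X B"
  unfolding hausdorff_dim_def using hausdorff_null_mono[OF _ assms] by (intro INF_superset_mono) auto

text \<open>Cover \<open>M\<^sub>0\<close> by its cylinders of length \<open>n\<close>, which have diameter at most \<open>(m + 1) ^ - n\<close>, and the
countable rest by single points, which cost nothing in positive dimension.\<close>

lemma hausdorff_null_if_few_prefixes: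
  assumes m: "1 \<le> m" and s: "0 < s"
    and M: "M \<subseteq> M\<^sub>0 \<union> C" "M \<subseteq> full_shift m" "M\<^sub>0 \<subseteq> full_shift m" and C: "countable C"
    and lim: "(\<lambda>n. real (card (prefix n ` M\<^sub>0)) * (real (m + 1) powr - s) ^ n) \<longlonglongrightarrow> 0"
  shows "hausdorff_measure (shift_metric m) s M = 0"
proof (rule hausdorff_measure_eq_0I)
  fix \<delta> \<epsilon> :: real assume \<delta>: "0 < \<delta>" and \<epsilon>: "0 < \<epsilon>"
  let ?X = "shift_metric m" and ?\<theta> = "real (m + 1) powr - s"
  have "\<forall>\<^sub>F n in sequentially. real (card (prefix n ` M\<^sub>0)) * ?\<theta> ^ n < \<epsilon>"
    using lim \<epsilon> by (rule order_tendstoD)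
  moreover have "(\<lambda>n. (1 / real (m + 1)) ^ n) \<longlonglongrightarrow> 0"
    using m by (intro LIMSEQ_realpow_zero) auto
  then have "\<forall>\<^sub>F n in sequentially. (1 / real (m + 1)) ^ n < \<delta>"
    using \<delta> by (rule order_tendstoD)
  ultimately have "\<forall>\<^sub>F n in sequentially. real (card (prefix n ` M\<^sub>0)) * ?\<theta> ^ n < \<epsilon> \<and> (1 / real (m + 1)) ^ n < \<delta>"
    by eventually_elim auto
  then obtain n where n: "real (card (prefix n ` M\<^sub>0)) * ?\<theta> ^ n < \<epsilon>" "1 / real (m + 1) ^ n < \<delta>"
    unfolding eventually_sequentially power_one_over by blast
  have "finite (prefix n ` M\<^sub>0)"
    by (rule finite_subset[OF _ finite_words[of n m]]) (use M(3) in \<open>fastforce simp: full_shift_def\<close>)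
  then obtain ws where ws: "set ws = prefix n ` M\<^sub>0" "distinct ws"
    using finite_distinct_list by blast
  define K where "K = length ws"
  have K: "K = card (prefix n ` M\<^sub>0)" unfolding K_def using ws distinct_card by metis
  define cyl where "cyl = (\<lambda>w. {x \<in> full_shift m. prefix n x = w})"
  \<comment> \<open>If \<open>C\<close> is empty, the points enumerated after the cylinders are arbitrary and only cost diameter \<open>0\<close>.\<close>
  define U where "U = (\<lambda>i. if i < K then cyl (ws ! i) else
      {from_nat_into C (i - K)} \<inter> full_shift m)"
  have dist_cyl: "mdist ?X x y \<le> 1 / real (m + 1) ^ n" if "x \<in> cyl w" "y \<in> cyl w" for x y w
  proof -
    have "prefix n x = prefix n y" using that by (auto simp: cyl_def)
    then show ?thesis
      using that m seq_dist_le_if_eq[of x m y n] unfolding prefix_eq_iff by (auto simp: cyl_def)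
  qed
  have diam0: "ediam ?X (U i) = 0" if "\<not> i < K" for i
  proof -
    have "ediam ?X (U i) \<le> ennreal 0"
      by (rule ediam_le) (use that in \<open>auto simp: U_def seq_dist_def\<close>)
    then show ?thesis by simp
  qed
  have "hausdorff_premeasure ?X s \<delta> M \<le> (\<Sum>i. diam_pow ?X s (U i))"
    unfolding hausdorff_premeasure_def
  proof (intro INF_lower CollectI conjI allI subsetI)
    fix x assume x: "x \<in> M"
    show "x \<in> (\<Union>i. U i)"
    proof (cases "x \<in> M\<^sub>0")
      case True
      then obtain i where "i < K" "prefix n x = ws ! i"
        using ws(1) unfolding K_def by (metis imageI in_set_conv_nth)
      then have "x \<in> U i" using x M(2) by (auto simp: U_def cyl_def)
      then show ?thesis by blast
    next
      case False
      then have "x \<in> C" using x M(1) by blast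
      then obtain i where "from_nat_into C i = x"
        using C by (metis from_nat_into_surj)
      then have "x \<in> U (K + i)" using x M(2) by (auto simp: U_def)
      then show ?thesis by blast
    qed
  next
    fix i
    show "ediam ?X (U i) \<le> ennreal \<delta>"
    proof (cases "i < K")
      case True
      have "ediam ?X (U i) \<le> ennreal (1 / real (m + 1) ^ n)"
        by (rule ediam_le) (use True dist_cyl in \<open>auto simp: U_def simp del: mdist_shift_metric\<close>)
      also have "\<dots> \<le> ennreal \<delta>" using n(2) by (intro ennreal_leI) simp
      finally show ?thesis .
    qed (simp add: diam0)
  qed (auto simp: U_def cyl_def split: if_splits)
  also have "\<dots> = (\<Sum>i<K. diam_pow ?X s (U i))"
    by (rule suminf_finite) (use diam0 s in \<open>auto simp: diam_pow_def\<close>)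
  also have "\<dots> \<le> (\<Sum>i<K. ennreal (?\<theta> ^ n))"
  proof (rule sum_mono)
    fix i assume i: "i \<in> {..<K}"
    have "ediam ?X (U i) \<le> ennreal (1 / real (m + 1) ^ n)"
      by (rule ediam_le) (use i dist_cyl in \<open>auto simp: U_def simp del: mdist_shift_metric\<close>)
    then have "enn2real (ediam ?X (U i)) \<le> 1 / real (m + 1) ^ n"
      by (intro enn2real_leI) auto
    then have "enn2real (ediam ?X (U i)) powr s \<le> (1 / real (m + 1) ^ n) powr s"
      using s by (intro powr_mono2) auto
    also have "\<dots> = ?\<theta> ^ n" by (rule powr_cylinder) simp
    finally show "diam_pow ?X s (U i) \<le> ennreal (?\<theta> ^ n)"
      using s by (auto simp: diam_pow_def intro: ennreal_leI)
  qed
  also have "\<dots> = ennreal (real K * ?\<theta> ^ n)"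
    by (simp add: ennreal_mult ennreal_of_nat_eq_real_of_nat)
  also have "\<dots> \<le> ennreal \<epsilon>"
    using n(1) K by (intro ennreal_leI) simp
  finally show "hausdorff_premeasure ?X s \<delta> M \<le> ennreal \<epsilon>" .
qed

text \<open>Sequences that are closer than \<open>(m + 1) ^ - l\<close> share their first \<open>l\<close> letters, so a small set lies in a
cylinder of comparable size. The error \<open>\<eta>\<close> serves sets of diameter \<open>0\<close>, which lie in arbitrarily
small cylinders. The bound on the diameter makes the word nonempty.\<close>

lemma cylinder_of_small_set:
  assumes m: "1 \<le> m" and s: "0 < s" and U: "U \<subseteq> full_shift m"
    and diam: "ediam (shift_metric m) U \<le> ennreal (1 / real (m + 1) ^ 2)" and \<eta>: "0 < \<eta>"
  obtains w where "w \<noteq> []" "\<And>x. x \<in> U \<Longrightarrow> prefix (length w) x = w"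
    "(real (m + 1) powr - s) ^ length w \<le>
       real (m + 1) powr s * enn2real (diam_pow (shift_metric m) s U) + \<eta>"
proof -
  let ?X = "shift_metric m" and ?\<theta> = "real (m + 1) powr - s" and ?b = "real (m + 1)"
  define D where "D = enn2real (ediam ?X U)"
  have \<theta>: "0 < ?\<theta>" "?\<theta> < 1" using m s by (auto simp: powr_less_one)
  have "\<exists>l\<ge>1. (U = {} \<or> D < 1 / ?b ^ l) \<and> ?\<theta> ^ l \<le> ?b powr s * enn2real (diam_pow ?X s U) + \<eta>"
  proof (cases "U = {} \<or> D = 0")
    case True
    have "(\<lambda>l. ?\<theta> ^ l) \<longlonglongrightarrow> 0" using \<theta> by (intro LIMSEQ_realpow_zero) auto
    then have "\<forall>\<^sub>F l in sequentially. ?\<theta> ^ l < \<eta>" using \<eta> by (rule order_tendstoD)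
    moreover have "\<forall>\<^sub>F l in sequentially. (1::nat) \<le> l" by (rule eventually_ge_at_top)
    ultimately have "\<forall>\<^sub>F l in sequentially. ?\<theta> ^ l < \<eta> \<and> 1 \<le> l" by eventually_elim auto
    then obtain l where l: "?\<theta> ^ l < \<eta>" "1 \<le> l" unfolding eventually_sequentially by blast
    moreover have "0 \<le> ?b powr s * enn2real (diam_pow ?X s U)" by simp
    ultimately have "?\<theta> ^ l \<le> ?b powr s * enn2real (diam_pow ?X s U) + \<eta>" by linarith
    with l True show ?thesis by (intro exI[of _ l]) auto
  next
    case False
    then have D: "0 < D" by (simp add: D_def less_le)
    \<comment> \<open>One letter less than \<open>L\<close> still determines a cylinder containing \<open>U\<close>.\<close>
    define L where "L = (LEAST l. 1 / ?b ^ l \<le> D)"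
    obtain l where "(1 / ?b) ^ l < D" using real_arch_pow_inv[OF D, of "1 / ?b"] m by auto
    then have "1 / ?b ^ l \<le> D" by (simp add: power_one_over)
    then have L: "1 / ?b ^ L \<le> D" unfolding L_def by (rule LeastI)
    have less: "D < 1 / ?b ^ l" if "l < L" for l
      using not_less_Least[of l "\<lambda>l. 1 / ?b ^ l \<le> D"] that unfolding L_def by simp
    have "D \<le> 1 / ?b ^ 2" unfolding D_def using diam by (intro enn2real_leI) auto
    with L have "1 / ?b ^ L \<le> 1 / ?b ^ 2" by linarith
    then have "?b ^ 2 \<le> ?b ^ L" by (simp add: divide_simps split: if_splits)
    then have "2 \<le> L" using m by (subst (asm) power_increasing_iff) auto
    have "?\<theta> ^ L = (1 / ?b ^ L) powr s" by (simp add: powr_cylinder)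
    also have "\<dots> \<le> D powr s" using L s by (intro powr_mono2) auto
    also have "\<dots> = enn2real (diam_pow ?X s U)"
      using False s by (simp add: diam_pow_def D_def)
    finally have "?\<theta> ^ L \<le> enn2real (diam_pow ?X s U)" .
    then have "?b powr s * ?\<theta> ^ L \<le> ?b powr s * enn2real (diam_pow ?X s U)"
      by (intro mult_left_mono) auto
    moreover have "?b powr s * ?\<theta> ^ L = ?\<theta> ^ (L - 1)"
      using \<open>2 \<le> L\<close> by (cases L) (simp_all add: powr_minus)
    ultimately have "?\<theta> ^ (L - 1) \<le> ?b powr s * enn2real (diam_pow ?X s U) + \<eta>"
      using \<eta> by linarith
    then show ?thesis
      using \<open>2 \<le> L\<close> less[of "L - 1"] by (intro exI[of _ "L - 1"]) auto
  qed
  then obtain l where l: "1 \<le> l" "U = {} \<or> D < 1 / ?b ^ l"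
      "?\<theta> ^ l \<le> ?b powr s * enn2real (diam_pow ?X s U) + \<eta>" by blast
  define w where "w = prefix l (SOME x. x \<in> U)"
  have "prefix l x = w" if x: "x \<in> U" for x
  proof -
    define y where "y = (SOME x. x \<in> U)"
    have y: "y \<in> U" unfolding y_def by (rule someI[of "\<lambda>y. y \<in> U", OF x])
    have "ediam ?X U < top" using diam by (rule le_less_trans) simp
    then have "seq_dist m x y \<le> D"
      using mdist_le_ediam[OF x y, of ?X] by (simp add: D_def)
    then have "seq_dist m x y < 1 / ?b ^ l" using l(2) x by auto
    then show ?thesis
      using seq_dist_less_imp_eq[of x m y l] x y U
      unfolding w_def y_def[symmetric] prefix_eq_iff by auto
  qed
  moreover have "length w = l" by (simp add: w_def)
  ultimately show thesis
    using l by (intro that[of w]) auto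
qed

lemma covering_by_cylinders:
  assumes m: "1 \<le> m" and s: "0 < s" and null: "hausdorff_measure (shift_metric m) s M = 0"
  obtains w :: "nat \<Rightarrow> nat list" where "\<And>i. w i \<noteq> []" "\<And>x. x \<in> M \<Longrightarrow> \<exists>i. prefix (length (w i)) x = w i"
    "\<And>k. (\<Sum>i<k. (real (m + 1) powr - s) ^ length (w i)) < 1"
proof -
  let ?X = "shift_metric m" and ?\<theta> = "real (m + 1) powr - s" and ?b = "real (m + 1)"
  \<comment> \<open>Half of the budget goes to the diameters of the given cover, half to the errors.\<close>
  define \<eta> where "\<eta> = 1 / (2 * ?b powr s)"
  have \<eta>: "0 < \<eta>" by (simp add: \<eta>_def)
  have "hausdorff_premeasure ?X s (1 / ?b ^ 2) M < ennreal \<eta>"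
    using hausdorff_premeasure_eq_0[OF null, of "1 / ?b ^ 2"] \<eta> by simp
  then obtain U where U: "M \<subseteq> (\<Union>n. U n)" "\<And>n. U n \<subseteq> full_shift m"
      "\<And>n. ediam ?X (U n) \<le> ennreal (1 / ?b ^ 2)" "(\<Sum>n. diam_pow ?X s (U n)) < ennreal \<eta>"
    unfolding hausdorff_premeasure_def INF_less_iff by (auto simp: image_iff)
  have "\<exists>w. w \<noteq> [] \<and> (\<forall>x\<in>U n. prefix (length w) x = w) \<and>
      ?\<theta> ^ length w \<le> ?b powr s * enn2real (diam_pow ?X s (U n)) + (1/2) * (1/2) ^ Suc n" for n
    by (rule cylinder_of_small_set[OF m s U(2,3), of "(1/2) * (1/2) ^ Suc n" n]) auto
  then obtain w where w: "\<And>n. w n \<noteq> []" "\<And>n x. x \<in> U n \<Longrightarrow> prefix (length (w n)) x = w n"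
      "\<And>n. ?\<theta> ^ length (w n) \<le> ?b powr s * enn2real (diam_pow ?X s (U n)) + (1/2) * (1/2) ^ Suc n"
    by metis
  have "(\<Sum>i<k. ?\<theta> ^ length (w i)) < 1" for k
  proof -
    let ?p = "\<lambda>n. enn2real (diam_pow ?X s (U n))"
    have "ennreal (\<Sum>i<k. ?p i) = (\<Sum>i<k. diam_pow ?X s (U i))"
      by (subst sum_ennreal[symmetric]) (simp_all flip: diam_pow_finite)
    also have "\<dots> \<le> (\<Sum>i. diam_pow ?X s (U i))" by (intro sum_le_suminf) auto
    also note U(4)
    finally have p: "(\<Sum>i<k. ?p i) < \<eta>" by (simp add: ennreal_less_iff sum_nonneg)
    have half: "(\<Sum>i<k. (1/2::real) ^ Suc i) = 1 - (1/2) ^ k"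
      by (induction k) auto
    have "(\<Sum>i<k. ?\<theta> ^ length (w i)) \<le> (\<Sum>i<k. ?b powr s * ?p i + (1/2) * (1/2) ^ Suc i)"
      by (intro sum_mono w(3))
    also have "\<dots> = ?b powr s * (\<Sum>i<k. ?p i) + (1/2) * (1 - (1/2) ^ k)"
      unfolding half[symmetric] by (simp only: sum.distrib sum_distrib_left)
    also have "\<dots> < ?b powr s * \<eta> + 1/2"
      using p by (intro add_less_le_mono mult_strict_left_mono) auto
    also have "\<dots> = 1" by (simp add: \<eta>_def)
    finally show ?thesis .
  qed
  moreover have "\<exists>i. prefix (length (w i)) x = w i" if "x \<in> M" for x
    using U(1) w(2) that by blast
  ultimately show thesis using w(1) by (intro that[of w]) auto
qed

section \<open>Outer approximations and compactness\<close>

lemma product_seq_compact: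
  fixes S :: "'a::countable \<Rightarrow> 'b::first_countable_topology set"
  assumes S: "\<And>i. compact (S i)" and X: "\<And>n i. X n i \<in> S i"
  obtains l r where "\<And>i. l i \<in> S i" "strict_mono (r :: nat \<Rightarrow> nat)" "(X \<circ> r) \<longlonglongrightarrow> l"
proof -
  have "compact (Pi\<^sub>E UNIV S)"
    using compactin_PiE[of "\<lambda>_. euclidean" UNIV S] S
    by (simp add: euclidean_product_topology)
  then have "seq_compact (Pi\<^sub>E UNIV S)" by (rule compact_imp_seq_compact)
  moreover have "\<forall>n. X n \<in> Pi\<^sub>E UNIV S" using X by auto
  ultimately obtain l r where "l \<in> Pi\<^sub>E UNIV S" "strict_mono (r :: nat \<Rightarrow> nat)" "(X \<circ> r) \<longlonglongrightarrow> l"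
    by (rule seq_compactE)
  then show thesis by (intro that[of l r]) auto
qed

lemma bounded_family_subsequence:
  fixes g :: "nat \<Rightarrow> 'a::countable \<Rightarrow> real"
  assumes "\<And>k p. \<bar>g k p\<bar> \<le> B"
  obtains h r where "strict_mono (r :: nat \<Rightarrow> nat)" "\<And>p. (\<lambda>k. g (r k) p) \<longlonglongrightarrow> h p"
proof -
  have "compact {- B..B}" "\<And>k p. g k p \<in> {- B..B}" using assms by (auto simp: abs_le_iff minus_le_iff)
  then obtain h r where r: "strict_mono (r :: nat \<Rightarrow> nat)" and h: "(g \<circ> r) \<longlonglongrightarrow> h"
    using product_seq_compact[of "\<lambda>_. {- B..B}" g] by blast
  have "(\<lambda>k. g (r k) p) \<longlonglongrightarrow> h p" for p
    using continuous_on_tendsto_compose[OF continuous_on_product_coordinates h]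
    by (simp add: comp_def)
  with r show thesis by (rule that)
qed

lemma open_finite_dependence:
  fixes P :: "(nat \<Rightarrow> nat) \<Rightarrow> bool"
  assumes "\<And>x y. (\<And>i. i < n \<Longrightarrow> x i = y i) \<Longrightarrow> P x \<Longrightarrow> P y"
  shows "open {x. P x}"
proof -
  have "open (\<Inter>i\<in>{..<n}. (\<lambda>y. y i) -` {x i})" for x :: "nat \<Rightarrow> nat"
    by (intro open_INT finite_lessThan ballI open_vimage continuous_on_product_coordinates)
       (simp add: open_discrete)
  then have "open (\<Union>x\<in>{x. P x}. (\<Inter>i\<in>{..<n}. (\<lambda>y. y i) -` {x i}))" by (intro open_UN) auto
  moreover have "(\<Union>x\<in>{x. P x}. (\<Inter>i\<in>{..<n}. (\<lambda>y. y i) -` {x i})) = {x. P x}"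
  proof (intro equalityI subsetI CollectI)
    fix y assume "y \<in> (\<Union>x\<in>{x. P x}. (\<Inter>i\<in>{..<n}. (\<lambda>y. y i) -` {x i}))"
    then obtain x where x: "P x" "\<forall>i<n. y i = x i" by auto
    show "P y" by (rule assms[OF _ x(1)]) (use x(2) in simp)
  qed auto
  ultimately show ?thesis by simp
qed

text \<open>The comparison as far as it is decided by the first \<open>k\<close> letters.\<close>

definition lex_upto :: "nat \<Rightarrow> (nat \<Rightarrow> nat) \<Rightarrow> (nat \<Rightarrow> nat) \<Rightarrow> bool" where
  "lex_upto k x y \<longleftrightarrow> (\<forall>j<k. (\<forall>i<j. x i = y i) \<longrightarrow> x j \<le> y j)"

lemma lex_upto_mono: "lex_upto k x y \<Longrightarrow> l \<le> k \<Longrightarrow> lex_upto l x y"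
  by (auto simp: lex_upto_def)

lemma lex_upto_cong:
  "(\<And>i. i < k \<Longrightarrow> x i = x' i) \<Longrightarrow> (\<And>i. i < k \<Longrightarrow> y i = y' i) \<Longrightarrow> lex_upto k x y \<longleftrightarrow> lex_upto k x' y'"
  by (auto simp: lex_upto_def)

lemma lex_le_iff_upto: "x \<sqsubseteq> y \<longleftrightarrow> (\<forall>k. lex_upto k x y)"
proof
  assume le: "x \<sqsubseteq> y"
  show "\<forall>k. lex_upto k x y"
    unfolding lex_upto_def
  proof (intro allI impI)
    fix k j assume "j < k" and eq: "\<forall>i<j. x i = y i"
    show "x j \<le> y j"
    proof (rule ccontr)
      assume "\<not> x j \<le> y j"
      then have "y \<sqsubset> x" unfolding less_fun_def using eq by (intro exI[of _ j]) auto
      then show False using le not_lex_less_iff by blast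
    qed
  qed
next
  assume upto: "\<forall>k. lex_upto k x y"
  show "x \<sqsubseteq> y"
  proof (rule ccontr)
    assume "\<not> x \<sqsubseteq> y"
    then obtain p where "y p < x p" "\<forall>i<p. y i = x i"
      unfolding not_lex_le_iff less_fun_def by blast
    moreover have "lex_upto (Suc p) x y" using upto by blast
    ultimately show False unfolding lex_upto_def by fastforce
  qed
qed

lemma mem_lex_subshift:
  "x \<in> lex_subshift m c d \<longleftrightarrow> x \<in> full_shift m \<and> (\<forall>n. c \<sqsubseteq> suffix n x \<and> suffix n x \<sqsubseteq> d)"
  by (simp add: lex_subshift_def shift_iterate)

lemma suffix_full_shift: "x \<in> full_shift m \<Longrightarrow> suffix n x \<in> full_shift m"
  by (simp add: full_shift_def)

lemma suffix_lex_subshift: "x \<in> lex_subshift m c d \<Longrightarrow> suffix n x \<in> lex_subshift m c d"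
  by (simp add: mem_lex_subshift suffix_full_shift)

lemma lex_subshift_antimono:
  "c' \<sqsubseteq> c \<Longrightarrow> d \<sqsubseteq> d' \<Longrightarrow> lex_subshift m c d \<subseteq> lex_subshift m c' d'"
  unfolding mem_lex_subshift subset_iff using lex_le_trans by blast

text \<open>Within the full shift, membership depends only on the first \<open>2 * k\<close> letters of the sequence and the first
\<open>k\<close> letters of \<open>c\<close> and \<open>d\<close>. Hence this is a closed set, and it contains the subshifts of all pairs that
agree with \<open>(c, d)\<close> for \<open>k\<close> letters.\<close>

definition outer_approx :: "nat \<Rightarrow> nat \<Rightarrow> (nat \<Rightarrow> nat) \<Rightarrow> (nat \<Rightarrow> nat) \<Rightarrow> (nat \<Rightarrow> nat) set" where
  "outer_approx m k c d = {x \<in> full_shift m. \<forall>n<k. lex_upto k c (suffix n x) \<and> lex_upto k (suffix n x) d}"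

lemma lex_subshift_subset_outer:
  assumes "\<And>i. i < k \<Longrightarrow> c' i = c i" "\<And>i. i < k \<Longrightarrow> d' i = d i"
  shows "lex_subshift m c' d' \<subseteq> outer_approx m k c d"
proof -
  have "lex_upto k c' y \<longleftrightarrow> lex_upto k c y" "lex_upto k y d' \<longleftrightarrow> lex_upto k y d" for y
    using assms by (intro lex_upto_cong; simp)+
  then show ?thesis
    unfolding outer_approx_def mem_lex_subshift lex_le_iff_upto subset_iff mem_Collect_eq by metis
qed

lemma outer_approx_antimono: "k \<le> l \<Longrightarrow> outer_approx m l c d \<subseteq> outer_approx m k c d"
  unfolding outer_approx_def using lex_upto_mono less_le_trans by blast

lemma mem_lex_subshift_if_outer: "(\<And>k. x \<in> outer_approx m k c d) \<Longrightarrow> x \<in> lex_subshift m c d"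
proof -
  assume *: "\<And>k. x \<in> outer_approx m k c d"
  have "lex_upto k c (suffix n x) \<and> lex_upto k (suffix n x) d" for k n
    using *[of "max k (Suc n)"] lex_upto_mono[of "max k (Suc n)" _ _ k] by (auto simp: outer_approx_def)
  then show ?thesis using *[of 0] by (auto simp: mem_lex_subshift lex_le_iff_upto outer_approx_def)
qed

text \<open>Otherwise there are uncovered points in all outer approximations; an accumulation point of them lies
in the subshift and is uncovered as well, because membership in a cylinder or in an outer
approximation is decided by finitely many letters.\<close>

lemma outer_approx_covered:
  fixes w :: "nat \<Rightarrow> nat list"
  assumes cover: "\<And>x. x \<in> lex_subshift m c d \<Longrightarrow> \<exists>i. prefix (length (w i)) x = w i"
  obtains k where "\<And>x. x \<in> outer_approx m k c d \<Longrightarrow> \<exists>i<k. prefix (length (w i)) x = w i"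
proof (rule ccontr)
  assume "\<not> thesis"
  define F where "F = (\<lambda>k. {x \<in> outer_approx m k c d. \<forall>i<k. prefix (length (w i)) x \<noteq> w i})"
  have "F k \<noteq> {}" for k
    using \<open>\<not> thesis\<close> that[of k] unfolding F_def by blast
  then have "\<forall>k. \<exists>x. x \<in> F k" by blast
  then obtain X where X: "\<And>k. X k \<in> F k" by metis
  have Xm: "X k i \<in> {..m}" for k i using X[of k] by (auto simp: F_def outer_approx_def full_shift_def)
  have "compact ({..m} :: nat set)" by (simp add: finite_imp_compact)
  from product_seq_compact[of "\<lambda>_. {..m} :: nat set" X, OF this Xm]
  obtain l r where l: "\<And>i. l i \<in> {..m}" and r: "strict_mono (r :: nat \<Rightarrow> nat)" and lim: "(X \<circ> r) \<longlonglongrightarrow> l"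
    by blast
  have near: "\<exists>j. k \<le> r j \<and> (\<forall>i<n. X (r j) i = l i)" for k n
  proof -
    have "open {x. \<forall>i<n. x i = l i}" by (rule open_finite_dependence[of n]) auto
    then have "\<forall>\<^sub>F j in sequentially. X (r j) \<in> {x. \<forall>i<n. x i = l i}"
      using lim by (auto simp: tendsto_def comp_def)
    moreover have "\<forall>\<^sub>F j in sequentially. k \<le> r j"
      using eventually_subseq[OF r eventually_ge_at_top[of k]] .
    ultimately have "\<forall>\<^sub>F j in sequentially. k \<le> r j \<and> X (r j) \<in> {x. \<forall>i<n. x i = l i}"
      by eventually_elim auto
    then show ?thesis unfolding eventually_sequentially by blast
  qed
  have "l \<in> outer_approx m k c d" for k
  proof -
    obtain j where j: "k \<le> r j" "\<forall>i<k + k. X (r j) i = l i" using near by blast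
    have "X (r j) \<in> outer_approx m k c d" using X[of "r j"] j(1) outer_approx_antimono unfolding F_def by blast
    moreover have "lex_upto k c (suffix n (X (r j))) \<longleftrightarrow> lex_upto k c (suffix n l)"
      "lex_upto k (suffix n (X (r j))) d \<longleftrightarrow> lex_upto k (suffix n l) d" if "n < k" for n
      using j(2) that by (intro lex_upto_cong; simp)+
    ultimately show ?thesis using l by (auto simp: outer_approx_def full_shift_def)
  qed
  then have "l \<in> lex_subshift m c d" by (rule mem_lex_subshift_if_outer)
  then obtain i where i: "prefix (length (w i)) l = w i" using cover by blast
  obtain j where j: "Suc i \<le> r j" "\<forall>i'<length (w i). X (r j) i' = l i'" using near by blast
  then have "prefix (length (w i)) (X (r j)) = w i"
    using i prefix_eq_iff by metis
  then show False using X[of "r j"] j(1) by (auto simp: F_def)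
qed

section \<open>Renewal estimates and upper semicontinuity\<close>

text \<open>A null set has a cover by cylinders of arbitrarily small total weight; compactness makes the cover finite
and extends it to a neighbourhood. Total weight at most \<open>1\<close> is what the renewal argument needs.\<close>

lemma covering_words:
  assumes m: "1 \<le> m" and s: "0 < s"
    and null: "hausdorff_measure (shift_metric m) s (lex_subshift m c d) = 0"
  obtains D k where "finite D" "[] \<notin> D" "(\<Sum>w\<in>D. (real (m + 1) powr - s) ^ length w) \<le> 1"
    "\<And>x. x \<in> outer_approx m k c d \<Longrightarrow> \<exists>w\<in>D. prefix (length w) x = w"
proof -
  obtain w :: "nat \<Rightarrow> nat list" where w: "\<And>i. w i \<noteq> []"
      "\<And>x. x \<in> lex_subshift m c d \<Longrightarrow> \<exists>i. prefix (length (w i)) x = w i"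
      "\<And>k. (\<Sum>i<k. (real (m + 1) powr - s) ^ length (w i)) < 1"
    using covering_by_cylinders[OF m s null] by metis
  obtain k where k: "\<And>x. x \<in> outer_approx m k c d \<Longrightarrow> \<exists>i<k. prefix (length (w i)) x = w i"
    using outer_approx_covered[of m c d w] w(2) by metis
  have "(\<Sum>v\<in>w ` {..<k}. (real (m + 1) powr - s) ^ length v) \<le> (\<Sum>i<k. (real (m + 1) powr - s) ^ length (w i))"
    using sum_image_le[of "{..<k}" "\<lambda>v. (real (m + 1) powr - s) ^ length v" w] by (simp add: comp_def)
  with w(3)[of k] have "(\<Sum>v\<in>w ` {..<k}. (real (m + 1) powr - s) ^ length v) \<le> 1" by linarith
  moreover have "[] \<notin> w ` {..<k}" using w(1) by (metis imageE)
  ultimately show thesis using k by (intro that[of "w ` {..<k}" k]) auto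
qed

text \<open>After weighting with \<open>\<theta> ^ n\<close> the recursion bounds \<open>g n\<close> by a subconvex combination of earlier values,
so a bound for an initial segment remains valid for all \<open>n\<close>.\<close>

lemma renewal_bound:
  fixes g :: "nat \<Rightarrow> real" and D :: "'a list set"
  assumes D: "finite D" "[] \<notin> D" "(\<Sum>w\<in>D. \<theta> ^ length w) \<le> 1" "0 < \<theta>"
    and g: "\<And>n. 0 \<le> g n" and n0: "\<And>w. w \<in> D \<Longrightarrow> length w \<le> n\<^sub>0"
    and rec: "\<And>n. n\<^sub>0 \<le> n \<Longrightarrow> g n \<le> (\<Sum>w\<in>D. g (n - length w))"
  obtains C where "\<And>n. g n * \<theta> ^ n \<le> C"
proof -
  define C where "C = (\<Sum>i<n\<^sub>0. g i * \<theta> ^ i)"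
  have C: "0 \<le> C" unfolding C_def using g D(4) by (intro sum_nonneg) auto
  have "g n * \<theta> ^ n \<le> C" for n
  proof (induction n rule: less_induct)
    case (less n)
    show ?case
    proof (cases "n < n\<^sub>0")
      case True
      then show ?thesis
        unfolding C_def using g D(4) by (intro member_le_sum) auto
    next
      case False
      have "g n * \<theta> ^ n \<le> (\<Sum>w\<in>D. g (n - length w)) * \<theta> ^ n"
        using rec[of n] False D(4) by (intro mult_right_mono) auto
      also have "\<dots> = (\<Sum>w\<in>D. (g (n - length w) * \<theta> ^ (n - length w)) * \<theta> ^ length w)"
        unfolding sum_distrib_right
      proof (intro sum.cong refl)
        fix w assume "w \<in> D"
        then have "\<theta> ^ n = \<theta> ^ (n - length w) * \<theta> ^ length w"
          using n0[of w] False by (simp flip: power_add)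
        then show "g (n - length w) * \<theta> ^ n = g (n - length w) * \<theta> ^ (n - length w) * \<theta> ^ length w"
          by (simp add: mult.assoc)
      qed
      also have "\<dots> \<le> (\<Sum>w\<in>D. C * \<theta> ^ length w)"
      proof (intro sum_mono mult_right_mono)
        fix w assume w: "w \<in> D"
        then have "0 < length w" using D(2) by (cases w) auto
        then have "n - length w < n" using n0[OF w] False by linarith
        then show "g (n - length w) * \<theta> ^ (n - length w) \<le> C" by (rule less.IH)
      qed (use D(4) in auto)
      also have "\<dots> \<le> C" unfolding sum_distrib_left[symmetric]
        using mult_left_mono[OF D(3) C] by simp
      finally show ?thesis .
    qed
  qed
  then show thesis by (rule that)
qed

lemma tendsto_0_smaller_base:
  fixes a :: "nat \<Rightarrow> real"
  assumes "\<And>n. 0 \<le> a n" "\<And>n. a n * \<theta> ^ n \<le> C * real (n + 1)" "0 \<le> t" "t < \<theta>"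
  shows "(\<lambda>n. a n * t ^ n) \<longlonglongrightarrow> 0"
proof (rule tendsto_sandwich[where f = "\<lambda>_. 0" and h = "\<lambda>n. C * (real n * (t / \<theta>) ^ n) + C * (t / \<theta>) ^ n"])
  let ?q = "t / \<theta>"
  have q: "\<bar>?q\<bar> < 1" using assms by simp
  have "(\<lambda>n. C * (real n * ?q ^ n) + C * ?q ^ n) \<longlonglongrightarrow> C * 0 + C * 0"
    using q by (intro tendsto_intros powser_times_n_limit_0 LIMSEQ_power_zero) auto
  then show "(\<lambda>n. C * (real n * ?q ^ n) + C * ?q ^ n) \<longlonglongrightarrow> 0" by simp
  show "\<forall>\<^sub>F n in sequentially. a n * t ^ n \<le> C * (real n * ?q ^ n) + C * ?q ^ n"
  proof (intro always_eventually allI)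
    fix n
    have "a n * t ^ n = (a n * \<theta> ^ n) * ?q ^ n"
      using assms(3,4) by (simp add: power_divide)
    also have "\<dots> \<le> (C * real (n + 1)) * ?q ^ n"
      using assms by (intro mult_right_mono) auto
    finally show "a n * t ^ n \<le> C * (real n * ?q ^ n) + C * ?q ^ n" by (simp add: algebra_simps)
  qed
  show "\<forall>\<^sub>F n in sequentially. 0 \<le> a n * t ^ n"
    using assms by (intro always_eventually) auto
qed auto

lemma summable_smaller_base:
  fixes a :: "nat \<Rightarrow> real"
  assumes "\<And>n. 0 \<le> a n" "\<And>n. a n * \<theta> ^ n \<le> C" "0 \<le> t" "t < \<theta>"
  shows "summable (\<lambda>n. a n * t ^ n)"
proof (rule summable_comparison_test')
  show "summable (\<lambda>n. C * (t / \<theta>) ^ n)"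
    using assms by (intro summable_mult summable_geometric) auto
  fix n
  have "a n * t ^ n = (a n * \<theta> ^ n) * (t / \<theta>) ^ n"
    using assms(3,4) by (simp add: power_divide)
  also have "\<dots> \<le> C * (t / \<theta>) ^ n"
    using assms by (intro mult_right_mono) auto
  finally show "norm (a n * t ^ n) \<le> C * (t / \<theta>) ^ n" using assms by simp
qed

lemma powr_base_strict:
  assumes "1 \<le> m" "s < s'"
  shows "real (m + 1) powr - s' < real (m + 1) powr - s"
  using assms by (intro powr_less_mono) auto

text \<open>Upper semicontinuity. The nearby subshift is invariant and covered by the cylinders of \<open>D\<close>, so removing
a first word of \<open>D\<close> maps its prefixes of length \<open>n\<close> to shorter prefixes of the same set. The gap
between \<open>s\<close> and \<open>s'\<close> turns boundedness of the weighted numbers into convergence to zero.\<close>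

lemma hausdorff_null_nearby:
  assumes m: "1 \<le> m" and s: "0 < s" "s < s'"
    and null: "hausdorff_measure (shift_metric m) s (lex_subshift m c d) = 0"
  obtains k where "\<And>c' d'. (\<And>i. i < k \<Longrightarrow> c' i = c i) \<Longrightarrow> (\<And>i. i < k \<Longrightarrow> d' i = d i) \<Longrightarrow>
    hausdorff_measure (shift_metric m) s' (lex_subshift m c' d') = 0"
proof -
  let ?\<theta> = "real (m + 1) powr - s"
  obtain D k where D: "finite D" "[] \<notin> D" "(\<Sum>w\<in>D. ?\<theta> ^ length w) \<le> 1"
      and k: "\<And>x. x \<in> outer_approx m k c d \<Longrightarrow> \<exists>w\<in>D. prefix (length w) x = w"
    using covering_words[OF m s(1) null] by metis
  have "hausdorff_measure (shift_metric m) s' (lex_subshift m c' d') = 0"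
    if agree: "\<And>i. i < k \<Longrightarrow> c' i = c i" "\<And>i. i < k \<Longrightarrow> d' i = d i" for c' d'
  proof -
    let ?M = "lex_subshift m c' d'"
    have fin: "finite (prefix n ` ?M)" for n
      by (rule finite_subset[OF _ finite_words[of n m]]) (auto simp: mem_lex_subshift full_shift_def)
    define n0 where "n0 = (\<Sum>w\<in>D. length w)"
    have n0: "length w \<le> n0" if "w \<in> D" for w
      unfolding n0_def using D(1) that by (intro member_le_sum) auto
    have rec: "real (card (prefix n ` ?M)) \<le> (\<Sum>w\<in>D. real (card (prefix (n - length w) ` ?M)))"
      if n: "n0 \<le> n" for n
    proof -
      have "prefix n ` ?M \<subseteq> (\<Union>w\<in>D. (\<lambda>v. w @ v) ` prefix (n - length w) ` ?M)"
      proof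
        fix u assume "u \<in> prefix n ` ?M"
        then obtain x where x: "x \<in> ?M" "u = prefix n x" by blast
        then obtain w where w: "w \<in> D" "prefix (length w) x = w"
          using k lex_subshift_subset_outer[of k c' c d' d m] agree by blast
        then have "u = w @ prefix (n - length w) (suffix (length w) x)"
          using n n0[OF w(1)] x(2) prefix_conc_snd[of w n "suffix (length w) x"]
          by (metis order_trans prefix_suffix)
        then show "u \<in> (\<Union>w\<in>D. (\<lambda>v. w @ v) ` prefix (n - length w) ` ?M)"
          using w(1) suffix_lex_subshift[OF x(1)] by blast
      qed
      then have "card (prefix n ` ?M) \<le> card (\<Union>w\<in>D. (\<lambda>v. w @ v) ` prefix (n - length w) ` ?M)"
        using D(1) fin by (intro card_mono) auto
      also have "\<dots> \<le> (\<Sum>w\<in>D. card ((\<lambda>v. w @ v) ` prefix (n - length w) ` ?M))"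
        by (rule card_UN_le[OF D(1)])
      also have "\<dots> \<le> (\<Sum>w\<in>D. card (prefix (n - length w) ` ?M))"
        by (intro sum_mono card_image_le fin)
      finally show ?thesis by (metis of_nat_mono of_nat_sum)
    qed
    obtain C where C: "\<And>n. real (card (prefix n ` ?M)) * ?\<theta> ^ n \<le> C"
      using renewal_bound[OF D _ _ n0 rec] m by auto
    have "0 \<le> C" using C[of 0] by (meson mult_nonneg_nonneg of_nat_0_le_iff order_trans powr_ge_zero zero_le_power)
    then have C': "real (card (prefix n ` ?M)) * ?\<theta> ^ n \<le> C * real (n + 1)" for n
      using C[of n] mult_left_mono[of 1 "real (n + 1)" C] by simp
    have "(\<lambda>n. real (card (prefix n ` ?M)) * (real (m + 1) powr - s') ^ n) \<longlonglongrightarrow> 0"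
      by (rule tendsto_0_smaller_base[OF _ C']) (use powr_base_strict[OF m s(2)] in auto)
    then show ?thesis
      using m s by (intro hausdorff_null_if_few_prefixes[where M\<^sub>0 = ?M and C = "{}"])
        (auto simp: mem_lex_subshift)
  qed
  then show thesis by (rule that)
qed

text \<open>The words counted here need not extend to points of the subshift. Nevertheless a long admissible
word followed by \<open>y\<close> belongs to an outer approximation, which is covered by the same cylinders, so
removing a first word of \<open>D\<close> works until the word gets short.\<close>

lemma word_count_bound:
  assumes m: "1 \<le> m" and s: "0 < s"
    and null: "hausdorff_measure (shift_metric m) s (lex_subshift m c d) = 0"
    and y: "y \<in> full_shift m"
  obtains C where "\<And>n. word_count m c d n y * (real (m + 1) powr - s) ^ n \<le> C"
proof -
  let ?\<theta> = "real (m + 1) powr - s"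
  obtain D k where D: "finite D" "[] \<notin> D" "(\<Sum>w\<in>D. ?\<theta> ^ length w) \<le> 1"
      and k: "\<And>x. x \<in> outer_approx m k c d \<Longrightarrow> \<exists>w\<in>D. prefix (length w) x = w"
    using covering_words[OF m s null] by metis
  \<comment> \<open>From this length on the word decides membership in the outer approximation and contains the
    word of \<open>D\<close> at its beginning.\<close>
  define n0 where "n0 = k + (\<Sum>w\<in>D. length w)"
  have n0: "length w \<le> n0" if "w \<in> D" for w
    unfolding n0_def using D(1) that by (intro trans_le_add2 member_le_sum) auto
  have rec: "word_count m c d n y \<le> (\<Sum>w\<in>D. word_count m c d (n - length w) y)" if n: "n0 \<le> n" for n
  proof -
    have "admissible m c d n y \<subseteq> (\<Union>w\<in>D. (\<lambda>v. w @ v) ` admissible m c d (n - length w) y)"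
    proof
      fix u assume u: "u \<in> admissible m c d n y"
      have "u ! i \<in> {..m}" if "i < length u" for i
        using u nth_mem[OF that] unfolding admissible_def by blast
      then have "(u \<frown> y) i \<le> m" for i
        using y by (cases "i < length u") (auto simp: full_shift_def)
      then have "u \<frown> y \<in> full_shift m" by (simp add: full_shift_def)
      moreover have "c \<sqsubseteq> suffix i (u \<frown> y) \<and> suffix i (u \<frown> y) \<sqsubseteq> d" if "i < k" for i
        using u n that by (auto simp: admissible_def n0_def intro!: lex_less_imp_le)
      ultimately have "u \<frown> y \<in> outer_approx m k c d"
        by (auto simp: outer_approx_def lex_le_iff_upto)
      then obtain w where w: "w \<in> D" "prefix (length w) (u \<frown> y) = w" using k by blast
      have len: "length w \<le> length u"
        using u n n0[OF w(1)] by (simp add: admissible_def)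
      then have uw: "u = w @ drop (length w) u"
        using w(2) by (metis append_take_drop_id prefix_conc_fst)
      have "suffix i (drop (length w) u \<frown> y) = suffix (length w + i) (u \<frown> y)" for i
        using len by (metis suffix_conc_fst suffix_suffix)
      then have "drop (length w) u \<in> admissible m c d (n - length w) y"
        using u len by (auto simp: admissible_def dest: in_set_dropD simp del: suffix_conc_fst)
      then show "u \<in> (\<Union>w\<in>D. (\<lambda>v. w @ v) ` admissible m c d (n - length w) y)"
        using w(1) uw by blast
    qed
    then have "card (admissible m c d n y) \<le> card (\<Union>w\<in>D. (\<lambda>v. w @ v) ` admissible m c d (n - length w) y)"
      using D(1) finite_admissible by (intro card_mono) auto
    also have "\<dots> \<le> (\<Sum>w\<in>D. card ((\<lambda>v. w @ v) ` admissible m c d (n - length w) y))"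
      by (rule card_UN_le[OF D(1)])
    also have "\<dots> \<le> (\<Sum>w\<in>D. card (admissible m c d (n - length w) y))"
      by (intro sum_mono card_image_le finite_admissible)
    finally show ?thesis unfolding word_count_def by (metis of_nat_mono of_nat_sum)
  qed
  show thesis
    using renewal_bound[OF D _ word_count_nonneg n0 rec] m that by auto
qed

section \<open>Dimension bounds from word counts\<close>

definition strict_points :: "nat \<Rightarrow> (nat \<Rightarrow> nat) \<Rightarrow> (nat \<Rightarrow> nat) \<Rightarrow> (nat \<Rightarrow> nat) set" where
  "strict_points m c d = {x \<in> full_shift m. \<forall>i. c \<sqsubset> suffix i x \<and> suffix i x \<sqsubset> d}"

text \<open>Take the longest suffix of the prefix that is itself a prefix of \<open>c\<close>, and let \<open>v\<close> be the part
before it. Putting \<open>c\<close> after \<open>v\<close> means lowering the tail of \<open>x\<close>, which preserves the upper bound. The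
lower bound could only fail by agreeing with \<open>c\<close> up to the end of the prefix, which would be a longer
match.\<close>

lemma strict_prefix_decomposition:
  assumes x: "x \<in> strict_points m c d"
  shows "\<exists>j\<le>n. \<exists>v\<in>admissible m c d (n - j) c. prefix n x = v @ prefix j c"
proof -
  define i0 where "i0 = (LEAST i. i \<le> n \<and> x [i \<rightarrow> n] = prefix (n - i) c)"
  have "i0 \<le> n \<and> x [i0 \<rightarrow> n] = prefix (n - i0) c"
    unfolding i0_def by (rule LeastI[of _ n]) simp
  then have i0: "i0 \<le> n" "x [i0 \<rightarrow> n] = prefix (n - i0) c" by auto
  have least: "x [i \<rightarrow> n] \<noteq> prefix (n - i) c" if "i < i0" for i
    using not_less_Least[of i "\<lambda>i. i \<le> n \<and> x [i \<rightarrow> n] = prefix (n - i) c"] that i0(1)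
    unfolding i0_def by auto
  define v where "v = prefix i0 x"
  have pre: "prefix n x = v @ prefix (n - i0) c"
    using i0 subsequence_append[of x i0 "n - i0"] by (simp add: v_def)
  have xv: "x = v \<frown> suffix i0 x" unfolding v_def by (rule prefix_suffix)
  have agree: "(v \<frown> c) i = x i" if "i < n" for i
  proof -
    have "prefix n (v \<frown> c) = prefix n x"
      unfolding pre using i0(1) by (simp add: v_def)
    then show ?thesis using that prefix_eq_iff by metis
  qed
  have "c \<sqsubset> suffix i (v \<frown> c) \<and> suffix i (v \<frown> c) \<sqsubset> d" if i: "i < i0" for i
  proof
    have ivl: "i \<le> length v" using i by (simp add: v_def)
    have "drop i v \<frown> c \<sqsubset> drop i v \<frown> suffix i0 x"
      using x by (simp add: lex_less_conc_iff strict_points_def)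
    also have "drop i v \<frown> suffix i0 x = suffix i x"
      using suffix_conc_fst[OF ivl] xv by metis
    finally have "suffix i (v \<frown> c) \<sqsubset> suffix i x"
      using suffix_conc_fst[OF ivl] by metis
    moreover have "suffix i x \<sqsubset> d" using x by (simp add: strict_points_def)
    ultimately show "suffix i (v \<frown> c) \<sqsubset> d" by (rule less_fun_trans)
    have "c \<sqsubset> suffix i x" using x by (simp add: strict_points_def)
    then obtain p where p: "c p < suffix i x p" "\<forall>q<p. c q = suffix i x q"
      unfolding less_fun_def by blast
    have "p < n - i"
    proof (rule ccontr)
      assume "\<not> p < n - i"
      then have "\<forall>q<n - i. suffix i x q = c q" using p(2) by simp
      then have "prefix (n - i) (suffix i x) = prefix (n - i) c" unfolding prefix_eq_iff .
      then show False using least[OF i] unfolding subsequence_prefix_suffix by simp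
    qed
    then have "suffix i (v \<frown> c) q = suffix i x q" if "q \<le> p" for q
      using agree[of "i + q"] that by simp
    then show "c \<sqsubset> suffix i (v \<frown> c)"
      unfolding less_fun_def using p by (intro exI[of _ p]) auto
  qed
  moreover have "set v \<subseteq> {..m}" using x by (auto simp: v_def strict_points_def full_shift_def)
  ultimately have "v \<in> admissible m c d (n - (n - i0)) c"
    using i0(1) by (auto simp: admissible_def v_def)
  then show ?thesis using pre i0(1) by (intro exI[of _ "n - i0"]) auto
qed

lemma card_strict_prefixes:
  "real (card (prefix n ` strict_points m c d)) \<le> (\<Sum>j\<le>n. word_count m c d (n - j) c)"
proof -
  have "prefix n ` strict_points m c d \<subseteq> (\<Union>j\<in>{..n}. (\<lambda>v. v @ prefix j c) ` admissible m c d (n - j) c)"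
    using strict_prefix_decomposition[of _ m c d n] by blast
  then have "card (prefix n ` strict_points m c d) \<le>
      card (\<Union>j\<in>{..n}. (\<lambda>v. v @ prefix j c) ` admissible m c d (n - j) c)"
    using finite_admissible by (intro card_mono) auto
  also have "\<dots> \<le> (\<Sum>j\<le>n. card ((\<lambda>v. v @ prefix j c) ` admissible m c d (n - j) c))"
    by (rule card_UN_le) simp
  also have "\<dots> \<le> (\<Sum>j\<le>n. card (admissible m c d (n - j) c))"
    by (intro sum_mono card_image_le finite_admissible)
  finally show ?thesis unfolding word_count_def by (metis of_nat_mono of_nat_sum)
qed

text \<open>Points of the subshift whose orbit meets \<open>c\<close> or \<open>d\<close> have the form \<open>v \<frown> c\<close> or \<open>v \<frown> d\<close>, so they
form a countable set. The prefixes of the others are counted by \<open>card_strict_prefixes\<close>.\<close>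

lemma hausdorff_null_if_word_count_bound:
  assumes m: "1 \<le> m" and s: "0 < s" and t: "real (m + 1) powr - s < t" "t \<le> 1"
    and C: "\<And>n. word_count m c d n c * t ^ n \<le> C"
  shows "hausdorff_measure (shift_metric m) s (lex_subshift m c d) = 0"
proof -
  let ?E = "(\<lambda>(v, e). v \<frown> e) ` (UNIV \<times> {c, d})"
  have t0: "0 < t" using t(1) by (meson le_less_trans powr_ge_zero)
  have bound: "real (card (prefix n ` strict_points m c d)) * t ^ n \<le> C * real (n + 1)" for n
  proof -
    have "real (card (prefix n ` strict_points m c d)) * t ^ n \<le> (\<Sum>j\<le>n. word_count m c d (n - j) c) * t ^ n"
      using t0 card_strict_prefixes by (intro mult_right_mono) auto
    also have "\<dots> \<le> (\<Sum>j\<le>n. C)"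
      unfolding sum_distrib_right
    proof (intro sum_mono)
      fix j assume "j \<in> {..n}"
      then have "word_count m c d (n - j) c * t ^ n \<le> word_count m c d (n - j) c * t ^ (n - j)"
        using t0 t(2) by (intro mult_left_mono power_decreasing) auto
      also have "\<dots> \<le> C" by (rule C)
      finally show "word_count m c d (n - j) c * t ^ n \<le> C" .
    qed
    finally show ?thesis by (simp add: mult.commute)
  qed
  have "(\<lambda>n. real (card (prefix n ` strict_points m c d)) * (real (m + 1) powr - s) ^ n) \<longlonglongrightarrow> 0"
    by (rule tendsto_0_smaller_base[OF _ bound]) (use t in auto)
  moreover have "lex_subshift m c d \<subseteq> strict_points m c d \<union> ?E"
  proof
    fix x assume x: "x \<in> lex_subshift m c d"
    show "x \<in> strict_points m c d \<union> ?E"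
    proof (cases "\<exists>i. suffix i x \<in> {c, d}")
      case True
      then obtain i where "suffix i x \<in> {c, d}" by blast
      then show ?thesis using prefix_suffix[of x i] by (intro UnI2 image_eqI[of _ _ "(prefix i x, suffix i x)"]) auto
    next
      case False
      then show ?thesis using x by (fastforce simp: mem_lex_subshift strict_points_def lex_le_def)
    qed
  qed
  moreover have "countable ?E" by (intro countable_image countable_SIGMA) auto
  ultimately show ?thesis
    using m s by (intro hausdorff_null_if_few_prefixes[where M\<^sub>0 = "strict_points m c d" and C = ?E])
      (auto simp: mem_lex_subshift strict_points_def)
qed

section \<open>Lower semicontinuity\<close>

text \<open>The largest sequence in the full shift with the same first \<open>k\<close> letters as \<open>c\<close>; dually, \<open>high_approx\<close> is
the smallest one with the same first letters as \<open>d\<close>. If \<open>c\<close> ends in \<open>m, m, \<dots>\<close> then \<open>low_approx\<close>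
is eventually \<open>c\<close> itself, since no sequence with a long common prefix lies above \<open>c\<close>.\<close>

definition low_approx :: "nat \<Rightarrow> (nat \<Rightarrow> nat) \<Rightarrow> nat \<Rightarrow> nat \<Rightarrow> nat" where
  "low_approx m c k = prefix k c \<frown> (\<lambda>_. m)"

definition high_approx :: "(nat \<Rightarrow> nat) \<Rightarrow> nat \<Rightarrow> nat \<Rightarrow> nat" where
  "high_approx d k = prefix k d \<frown> (\<lambda>_. 0)"

lemma approx_agree: "i < k \<Longrightarrow> low_approx m c k i = c i" "i < k \<Longrightarrow> high_approx d k i = d i"
  by (simp_all add: low_approx_def high_approx_def)

lemma approx_full_shift:
  "c \<in> full_shift m \<Longrightarrow> low_approx m c k \<in> full_shift m"
  "d \<in> full_shift m \<Longrightarrow> high_approx d k \<in> full_shift m"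
  by (auto simp: full_shift_def low_approx_def high_approx_def conc_def)

lemma lex_le_low_approx:
  assumes "c' \<in> full_shift m" "\<And>i. i < k \<Longrightarrow> c' i = c i"
  shows "c' \<sqsubseteq> low_approx m c k"
proof -
  have "prefix k c' = prefix k c" using assms(2) prefix_eq_iff by blast
  moreover have "suffix k c' \<sqsubseteq> (\<lambda>_. m)"
    using assms(1) unfolding not_lex_less_iff[symmetric] less_fun_def full_shift_def
    by (auto simp: not_less)
  ultimately show ?thesis
    unfolding low_approx_def by (metis lex_le_conc_iff prefix_suffix)
qed

lemma high_approx_lex_le:
  assumes "\<And>i. i < k \<Longrightarrow> d' i = d i"
  shows "high_approx d k \<sqsubseteq> d'"
proof -
  have "prefix k d' = prefix k d" using assms prefix_eq_iff by blast
  moreover have "(\<lambda>_. 0) \<sqsubseteq> suffix k d'"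
    unfolding not_lex_less_iff[symmetric] less_fun_def by auto
  ultimately show ?thesis
    unfolding high_approx_def by (metis lex_le_conc_iff prefix_suffix)
qed

lemma eventually_lex_less:
  fixes x y :: "nat \<Rightarrow> nat"
  assumes "x \<sqsubset> y" "\<And>k i. i < k \<Longrightarrow> xs k i = x i" "\<And>k i. i < k \<Longrightarrow> ys k i = y i"
  shows "\<forall>\<^sub>F k in sequentially. xs k \<sqsubset> ys k"
proof -
  obtain K where K: "\<And>x' y'. (\<forall>i<K. x' i = x i) \<Longrightarrow> (\<forall>i<K. y' i = y i) \<Longrightarrow> x' \<sqsubset> y'"
    using lex_less_stable[OF assms(1)] by blast
  show ?thesis
    using eventually_ge_at_top[of K] by eventually_elim (intro K; use assms in auto)
qed

text \<open>Only finitely many strict inequalities are involved, and they persist although the tail \<open>c\<close> of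
the sequences is changed together with the bounds.\<close>

lemma admissible_stable:
  assumes cs: "\<And>k i. i < k \<Longrightarrow> cs k i = c i" and ds: "\<And>k i. i < k \<Longrightarrow> ds k i = d i"
  shows "\<forall>\<^sub>F k in sequentially. admissible m c d n c \<subseteq> admissible m (cs k) (ds k) n (cs k)"
proof -
  have "\<forall>\<^sub>F k in sequentially. \<forall>v\<in>admissible m c d n c. \<forall>i\<in>{..<n}.
      cs k \<sqsubset> suffix i (v \<frown> cs k) \<and> suffix i (v \<frown> cs k) \<sqsubset> ds k"
  proof (intro eventually_ball_finite finite_admissible ballI finite_lessThan)
    fix v i assume v: "v \<in> admissible m c d n c" and i: "i \<in> {..<n}"
    have "suffix i (v \<frown> cs k) q = suffix i (v \<frown> c) q" if "q < k" for k q
      using v i that cs[of "i + q - n" k] by (auto simp: admissible_def conc_def)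
    then have "\<forall>\<^sub>F k in sequentially. cs k \<sqsubset> suffix i (v \<frown> cs k)"
        "\<forall>\<^sub>F k in sequentially. suffix i (v \<frown> cs k) \<sqsubset> ds k"
      using v i cs ds by (intro eventually_lex_less[of c "suffix i (v \<frown> c)"]
          eventually_lex_less[of "suffix i (v \<frown> c)" d]; simp add: admissible_def)+
    then show "\<forall>\<^sub>F k in sequentially. cs k \<sqsubset> suffix i (v \<frown> cs k) \<and> suffix i (v \<frown> cs k) \<sqsubset> ds k"
      by eventually_elim simp
  qed
  then show ?thesis by eventually_elim (auto simp: admissible_def)
qed

text \<open>Lower semicontinuity. The generating functions at \<open>c\<^sub>k\<close> equal a quotient that converges
along a subsequence, provided \<open>t\<close> is not a zero of the limiting determinant; hence they are bounded at
\<open>t\<close>, and so are the counts for \<open>(c, d)\<close>.\<close>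

lemma hausdorff_null_limit:
  assumes m: "1 \<le> m" and c: "c \<in> full_shift m" and d: "d \<in> full_shift m" and cd: "c \<sqsubset> d"
    and s: "0 < s" "s < s'"
    and null: "\<And>k. hausdorff_measure (shift_metric m) s
      (lex_subshift m (low_approx m c k) (high_approx d k)) = 0"
  shows "hausdorff_measure (shift_metric m) s' (lex_subshift m c d) = 0"
proof -
  let ?b = "real (m + 1)"
  let ?\<theta> = "?b powr - s"
  let ?\<Delta> = "real (d 0) - real (c 0)"
  define cs where "cs = low_approx m c"
  define ds where "ds = high_approx d"
  have agree: "cs k i = c i" "ds k i = d i" if "i < k" for k i
    using that approx_agree by (simp_all add: cs_def ds_def)
  have full: "cs k \<in> full_shift m" "ds k \<in> full_shift m" for k
    using c d approx_full_shift by (simp_all add: cs_def ds_def)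
  have "\<forall>\<^sub>F k in sequentially. cs k \<sqsubset> ds k"
    by (rule eventually_lex_less[OF cd]) (auto simp: agree)
  then obtain k0 where k0: "\<And>k. k0 \<le> k \<Longrightarrow> cs k \<sqsubset> ds k"
    unfolding eventually_sequentially by blast
  have \<theta>: "?b powr - s' < ?\<theta>" "?\<theta> < 1"
    using powr_base_strict[OF m s(2)] powr_base_strict[OF m s(1)] by simp_all
  \<comment> \<open>From index \<open>1\<close> on the first letters, and with them \<open>\<Delta>\<close>, are those of \<open>c\<close> and \<open>d\<close>.\<close>
  define g where "g = (\<lambda>k. knead_coeff (cs (Suc (k0 + k))) (ds (Suc (k0 + k))))"
  have g: "\<bar>g k p\<bar> \<le> real m" for k p
    unfolding g_def using full m by (intro knead_coeff_bound) (auto simp: full_shift_def)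
  obtain h r where r: "strict_mono (r :: nat \<Rightarrow> nat)" and h: "\<And>p. (\<lambda>k. g (r k) p) \<longlonglongrightarrow> h p"
    using bounded_family_subsequence[of g, OF g] by blast
  have h_le: "\<bar>h p\<bar> \<le> real m" for p
    by (rule LIMSEQ_le_const2[OF tendsto_rabs[OF h]]) (use g in auto)
  have h_0: "h (q, 0) = 0" for q
    using h[of "(q, 0)"] LIMSEQ_unique[OF _ tendsto_const] by (simp add: g_def)
  have "0 < ?b powr - s'" "?\<theta> \<le> 1" using \<theta>(2) by auto
  from knead_det_nonzero[of h "real m" "?b powr - s'" ?\<theta> ?\<Delta>, OF h_le h_0 this(1) \<theta>(1) this(2)]
  obtain t where t: "?b powr - s' < t" "t < ?\<theta>" "knead_det h ?\<Delta> t \<noteq> 0" by blast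
  have t01: "0 < t" "t < 1" using t(1,2) \<theta>(2) by (auto intro: le_less_trans[OF powr_ge_zero])
  define kk where "kk = (\<lambda>k. Suc (k0 + r k))"
  define A where "A = (\<lambda>k. \<Sum>n. word_count m (cs (kk k)) (ds (kk k)) n (cs (kk k)) * t ^ n)"
  have sums: "summable (\<lambda>n. word_count m (cs k) (ds k) n y * t ^ n)" if y: "y \<in> full_shift m" for k y
  proof -
    obtain C where "\<And>n. word_count m (cs k) (ds k) n y * ?\<theta> ^ n \<le> C"
      using word_count_bound[OF m s(1) null y] unfolding cs_def ds_def by blast
    then show ?thesis
      using t01 t(2) by (intro summable_smaller_base[of _ ?\<theta> C]) auto
  qed
  have A: "A k * knead_det (g (r k)) ?\<Delta> t = knead_num (g (r k)) t" for k
  proof -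
    interpret kneading m "cs (kk k)" "ds (kk k)"
      by unfold_locales (use full k0 in \<open>auto simp: full_shift_def kk_def\<close>)
    have "real (ds (kk k) 0) - real (cs (kk k) 0) = ?\<Delta>" by (simp add: agree kk_def)
    then show ?thesis
      using knead_identity[OF m _ _ sums sums] t01 full by (simp add: A_def g_def kk_def)
  qed
  have "(\<lambda>k. knead_num (g (r k)) t / knead_det (g (r k)) ?\<Delta> t) \<longlonglongrightarrow> knead_num h t / knead_det h ?\<Delta> t"
    using t(3) t01 by (intro tendsto_divide knead_det_tendsto[where M = "real m"] g h) auto
  then have "\<forall>\<^sub>F k in sequentially. knead_num (g (r k)) t / knead_det (g (r k)) ?\<Delta> t < knead_num h t / knead_det h ?\<Delta> t + 1"
    by (rule order_tendstoD) simp
  moreover have "(\<lambda>k. knead_det (g (r k)) ?\<Delta> t) \<longlonglongrightarrow> knead_det h ?\<Delta> t"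
    using t01 by (intro knead_det_tendsto[where M = "real m"] g h) auto
  then have "\<forall>\<^sub>F k in sequentially. knead_det (g (r k)) ?\<Delta> t \<noteq> 0"
    using t(3) by (rule tendsto_imp_eventually_ne)
  ultimately have A_bound: "\<forall>\<^sub>F k in sequentially. A k \<le> knead_num h t / knead_det h ?\<Delta> t + 1"
  proof eventually_elim
    case (elim k)
    have "A k = knead_num (g (r k)) t / knead_det (g (r k)) ?\<Delta> t"
      using A[of k] elim(2) by (metis nonzero_mult_div_cancel_right)
    then show ?case using elim(1) by linarith
  qed
  have "word_count m c d n c * t ^ n \<le> knead_num h t / knead_det h ?\<Delta> t + 1" for n
  proof -
    have kk: "filterlim kk sequentially sequentially"
      by (rule filterlim_subseq) (use r in \<open>simp add: kk_def strict_mono_def\<close>)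
    have "\<forall>\<^sub>F k in sequentially. admissible m c d n c \<subseteq> admissible m (cs k) (ds k) n (cs k)"
      by (rule admissible_stable) (auto simp: agree)
    then have "\<forall>\<^sub>F k in sequentially. admissible m c d n c \<subseteq>
        admissible m (cs (kk k)) (ds (kk k)) n (cs (kk k))"
      using kk by (rule eventually_compose_filterlim)
    with A_bound have "\<forall>\<^sub>F k in sequentially. word_count m c d n c * t ^ n \<le> knead_num h t / knead_det h ?\<Delta> t + 1"
    proof eventually_elim
      case (elim k)
      have "word_count m c d n c \<le> word_count m (cs (kk k)) (ds (kk k)) n (cs (kk k))"
        unfolding word_count_def using card_mono[OF finite_admissible elim(2)] by simp
      then have "word_count m c d n c * t ^ n \<le> word_count m (cs (kk k)) (ds (kk k)) n (cs (kk k)) * t ^ n"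
        using t01 by (intro mult_right_mono) auto
      also have "\<dots> \<le> A k"
        unfolding A_def using sum_le_suminf[OF sums[OF full(1)], of "{n}"] t01 by simp
      finally show ?case using elim(1) by linarith
    qed
    then show ?thesis using eventually_happens by fastforce
  qed
  then show ?thesis
    using s t01 by (intro hausdorff_null_if_word_count_bound[OF m _ t(1)]) auto
qed

section \<open>Continuity\<close>

theorem theorem8:
  fixes m :: nat
  assumes "1 \<le> m"
  shows "continuous_on {(c, d). c \<in> full_shift m \<and> d \<in> full_shift m \<and> less_fun c d}
    (\<lambda>(c, d). hausdorff_dim (shift_metric m) (lex_subshift m c d))"
proof -
  let ?S = "{(c, d). c \<in> full_shift m \<and> d \<in> full_shift m \<and> less_fun c d}"
  let ?dim = "\<lambda>c d. hausdorff_dim (shift_metric m) (lex_subshift m c d)"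
  show ?thesis
    unfolding continuous_on_def
  proof (intro ballI)
    fix p assume p: "p \<in> ?S"
    then obtain c d where cd: "p = (c, d)" "c \<in> full_shift m" "d \<in> full_shift m" "c \<sqsubset> d" by blast
    have near: "\<forall>\<^sub>F q in at p within ?S. q \<in> ?S \<and> (\<forall>i<k. fst q i = c i) \<and> (\<forall>i<k. snd q i = d i)" for k
    proof -
      have "open ({x. \<forall>i<k. x i = c i} \<times> {x. \<forall>i<k. x i = d i})"
        by (intro open_Times open_finite_dependence[of k]) auto
      then have "\<forall>\<^sub>F q in at p within ?S. q \<in> {x. \<forall>i<k. x i = c i} \<times> {x. \<forall>i<k. x i = d i}"
        unfolding eventually_at_topological
        by (intro exI[of _ "{x. \<forall>i<k. x i = c i} \<times> {x. \<forall>i<k. x i = d i}"]) (simp add: cd(1))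
      moreover have "\<forall>\<^sub>F q in at p within ?S. q \<in> ?S"
        unfolding eventually_at_topological by blast
      ultimately show ?thesis by eventually_elim auto
    qed
    have "((\<lambda>q. ?dim (fst q) (snd q)) \<longlongrightarrow> ?dim c d) (at p within ?S)"
    proof (rule order_tendstoI)
      fix a assume a: "a < ?dim c d"
      then obtain r where r: "a = ennreal r" "0 \<le> r" by (cases a) auto
      obtain k where k: "a < ?dim (low_approx m c k) (high_approx d k)"
      proof (rule ccontr)
        assume "\<not> thesis"
        then have le: "?dim (low_approx m c k) (high_approx d k) \<le> ennreal r" for k
          using that r(1) by (metis not_le)
        have "?dim c d \<le> ennreal r"
        proof (rule hausdorff_dim_leI[OF r(2)])
          fix s' assume s': "r < s'"
          define s where "s = (r + s') / 2"
          have s: "0 < s" "r < s" "s < s'" using s' r(2) by (auto simp: s_def)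
          have "?dim (low_approx m c k) (high_approx d k) < ennreal s" for k
            using le[of k] s(2) r(2) by (meson ennreal_lessI le_less_trans s(1))
          then show "hausdorff_measure (shift_metric m) s' (lex_subshift m c d) = 0"
            using hausdorff_null_limit[OF assms cd(2-4) s(1,3)] hausdorff_measure_eq_0_if_dim_less by blast
        qed
        then show False using a r(1) by simp
      qed
      show "\<forall>\<^sub>F q in at p within ?S. a < ?dim (fst q) (snd q)"
        using near[of k]
      proof eventually_elim
        case (elim q)
        then have "lex_subshift m (low_approx m c k) (high_approx d k) \<subseteq> lex_subshift m (fst q) (snd q)"
          by (intro lex_subshift_antimono lex_le_low_approx high_approx_lex_le) auto
        then show ?case using k hausdorff_dim_mono less_le_trans by blast
      qed
    next
      fix a assume "?dim c d < a"
      then obtain a1 where a1: "?dim c d < a1" "a1 < a" using dense by blast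
      then obtain a2 where a2: "a1 < a2" "a2 < a" using dense by blast
      obtain s where s: "a1 = ennreal s" "0 \<le> s" using a1(2) by (cases a1) auto
      obtain s' where s': "a2 = ennreal s'" "0 \<le> s'" using a2(2) by (cases a2) auto
      have "0 < s" using a1(1) s by (cases "s = 0") auto
      have "s < s'" using a2(1) s s' by (simp add: ennreal_less_iff)
      have "hausdorff_measure (shift_metric m) s (lex_subshift m c d) = 0"
        using a1(1) s(1) hausdorff_measure_eq_0_if_dim_less by simp
      from hausdorff_null_nearby[OF assms \<open>0 < s\<close> \<open>s < s'\<close> this]
      obtain k where k: "\<And>c' d'. (\<And>i. i < k \<Longrightarrow> c' i = c i) \<Longrightarrow> (\<And>i. i < k \<Longrightarrow> d' i = d i) \<Longrightarrow>
          hausdorff_measure (shift_metric m) s' (lex_subshift m c' d') = 0" by blast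
      show "\<forall>\<^sub>F q in at p within ?S. ?dim (fst q) (snd q) < a"
        using near[of k]
      proof eventually_elim
        case (elim q)
        then have "hausdorff_measure (shift_metric m) s' (lex_subshift m (fst q) (snd q)) = 0"
          by (intro k) auto
        then have "?dim (fst q) (snd q) \<le> ennreal s'"
          unfolding hausdorff_dim_def using s'(2) by (intro INF_lower) auto
        then show ?case using a2(2) s'(1) by simp
      qed
    qed
    then show "((\<lambda>(c, d). ?dim c d) \<longlongrightarrow> (case p of (c, d) \<Rightarrow> ?dim c d)) (at p within ?S)"
      by (simp add: case_prod_unfold cd(1))
  qed
qed

end
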